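(* Let $J$ be a bicritical cubic graph, and let $B$ be a barrier of a matching covered graph $G$. If $G$ is $J$-based, then $G/\overline{V(L)}$ is $J$-based for some component $L$ of $G-B$.
   Context: Graphs loopless; multiple edges allowed. A connected graph with at least two vertices is matching covered if every edge lies in a perfect matching. $J$ is bicritical if it has a perfect matching and $J-u-v$ has a perfect matching for all distinct $u,v$. A barrier of a graph with a perfect matching is a set $B$ of vertices such that the number of odd components of $G-B$ equals $|B|$. For $X\subseteq V(G)$, $G/\overline{X}$ is obtained by shrinking $V(G)-X$ to a single vertex. A subgraph $H$ of $G$ is conformal if $G-V(H)$ has a perfect matching; a bisubdivision of $J$ is obtained by replacing some edges of $J$ by paths with an even number of internal vertices; a matching covered graph is $J$-based if it has a conformal subgraph that is a bisubdivision of $J$. *)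

theory Defs
  imports Main
begin

text \<open>
  Finite multigraphs: edges are abstract objects, so parallel edges are distinct elements of
  \<open>edges G\<close> with the same set of ends; an edge with two ends is not a loop. The null graph is
  allowed, since \<open>G - V(H)\<close> and \<open>J - u - v\<close> may be null; it has the empty perfect matching.
\<close>

record ('v, 'e) ugraph =
  verts :: "'v set"
  edges :: "'e set"
  ends :: "'e \<Rightarrow> 'v set"

definition multigraph :: "('v, 'e) ugraph \<Rightarrow> bool" where
  "multigraph G \<longleftrightarrow> finite (verts G) \<and> finite (edges G) \<and>
     (\<forall>e\<in>edges G. ends G e \<subseteq> verts G \<and> card (ends G e) = 2)"

text \<open>
  A subgraph carries the incidence function of the host graph unchanged. Hence distinct
  subgraphs differ in their vertices or edges, and subgraphs can be counted.
\<close>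

definition subgraph :: "('v, 'e) ugraph \<Rightarrow> ('v, 'e) ugraph \<Rightarrow> bool" where
  "subgraph H G \<longleftrightarrow> multigraph H \<and> verts H \<subseteq> verts G \<and> edges H \<subseteq> edges G \<and> ends H = ends G"

definition del_verts :: "('v, 'e) ugraph \<Rightarrow> 'v set \<Rightarrow> ('v, 'e) ugraph" where
  "del_verts G X =
     \<lparr>verts = verts G - X, edges = {e \<in> edges G. ends G e \<inter> X = {}}, ends = ends G\<rparr>"

definition adj :: "('v, 'e) ugraph \<Rightarrow> 'v rel" where
  "adj G = {(u, v). \<exists>e\<in>edges G. ends G e = {u, v}}"

definition connected_graph :: "('v, 'e) ugraph \<Rightarrow> bool" where
  "connected_graph G \<longleftrightarrow> verts G \<noteq> {} \<and> (\<forall>u\<in>verts G. \<forall>v\<in>verts G. (u, v) \<in> (adj G)\<^sup>*)"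

definition component :: "('v, 'e) ugraph \<Rightarrow> ('v, 'e) ugraph \<Rightarrow> bool" where
  "component L G \<longleftrightarrow> subgraph L G \<and> connected_graph L \<and>
     (\<forall>K. subgraph K G \<and> connected_graph K \<and> subgraph L K \<longrightarrow> K = L)"

definition cubic :: "('v, 'e) ugraph \<Rightarrow> bool" where
  "cubic G \<longleftrightarrow> (\<forall>v\<in>verts G. card {e \<in> edges G. v \<in> ends G e} = 3)"

definition perfect_matching :: "('v, 'e) ugraph \<Rightarrow> 'e set \<Rightarrow> bool" where
  "perfect_matching G M \<longleftrightarrow> M \<subseteq> edges G \<and> (\<forall>v\<in>verts G. \<exists>!e. e \<in> M \<and> v \<in> ends G e)"

definition matchable :: "('v, 'e) ugraph \<Rightarrow> bool" where
  "matchable G \<longleftrightarrow> (\<exists>M. perfect_matching G M)"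

definition matching_covered :: "('v, 'e) ugraph \<Rightarrow> bool" where
  "matching_covered G \<longleftrightarrow> connected_graph G \<and> card (verts G) \<ge> 2 \<and>
     (\<forall>e\<in>edges G. \<exists>M. perfect_matching G M \<and> e \<in> M)"

definition bicritical :: "('v, 'e) ugraph \<Rightarrow> bool" where
  "bicritical G \<longleftrightarrow> matchable G \<and>
     (\<forall>u\<in>verts G. \<forall>v\<in>verts G. u \<noteq> v \<longrightarrow> matchable (del_verts G {u, v}))"

definition barrier :: "('v, 'e) ugraph \<Rightarrow> 'v set \<Rightarrow> bool" where
  "barrier G B \<longleftrightarrow> matchable G \<and> B \<subseteq> verts G \<and>
     card {L. component L (del_verts G B) \<and> odd (card (verts L))} = card B"

text \<open>
  \<open>shrink G Y\<close> identifies the vertices in \<open>Y\<close> to the single vertex \<open>None\<close> and discards the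
  edges with both ends in \<open>Y\<close>, which would become loops; parallel edges are kept. If \<open>Y\<close>
  is empty then no vertex is added and the result is a copy of \<open>G\<close>. In \<open>shrink_compl G X\<close>
  it is the complement of \<open>X\<close> that is shrunk.
\<close>

definition shrink :: "('v, 'e) ugraph \<Rightarrow> 'v set \<Rightarrow> ('v option, 'e) ugraph" where
  "shrink G Y = (let f = (\<lambda>v. if v \<in> Y then None else Some v) in
     \<lparr>verts = f ` verts G, edges = {e \<in> edges G. \<not> ends G e \<subseteq> Y}, ends = (\<lambda>e. f ` ends G e)\<rparr>)"

definition shrink_compl :: "('v, 'e) ugraph \<Rightarrow> 'v set \<Rightarrow> ('v option, 'e) ugraph" where
  "shrink_compl G X = shrink G (verts G - X)"

definition conformal :: "('v, 'e) ugraph \<Rightarrow> ('v, 'e) ugraph \<Rightarrow> bool" where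
  "conformal H G \<longleftrightarrow> subgraph H G \<and> matchable (del_verts G (verts H))"

text \<open>A path is given by its list of vertices together with its list of edges.\<close>

definition is_path :: "('v, 'e) ugraph \<Rightarrow> 'v list \<Rightarrow> 'e list \<Rightarrow> bool" where
  "is_path G vs es \<longleftrightarrow> set vs \<subseteq> verts G \<and> set es \<subseteq> edges G \<and> distinct vs \<and>
     length vs = Suc (length es) \<and> (\<forall>i<length es. ends G (es ! i) = {vs ! i, vs ! Suc i})"

definition internal :: "'v list \<Rightarrow> 'v list" where
  "internal vs = butlast (tl vs)"

text \<open>
  \<open>bisubdivision H J\<close> holds if \<open>H\<close> arises, up to isomorphism, from \<open>J\<close> by replacing every edge
  \<open>e\<close> by a path with an even number of internal vertices, all of them new and private to \<open>e\<close>.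
  A path with no internal vertices is a single edge, so that edge is left unsubdivided. The
  map \<open>\<phi>\<close> embeds the vertices of \<open>J\<close>; the path for \<open>e\<close> has vertices \<open>pv e\<close> and edges \<open>pe e\<close>.
  Disjointness of the edge lists matters when parallel edges of \<open>J\<close> are left unsubdivided.
\<close>

definition bisubdivision :: "('w, 'f) ugraph \<Rightarrow> ('v, 'e) ugraph \<Rightarrow> bool" where
  "bisubdivision H J \<longleftrightarrow> (\<exists>(\<phi> :: 'v \<Rightarrow> 'w) (pv :: 'e \<Rightarrow> 'w list) (pe :: 'e \<Rightarrow> 'f list).
     inj_on \<phi> (verts J) \<and>
     (\<forall>e\<in>edges J. is_path H (pv e) (pe e) \<and>
        {hd (pv e), last (pv e)} = \<phi> ` ends J e \<and>
        even (length (internal (pv e))) \<and>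
        set (internal (pv e)) \<inter> \<phi> ` verts J = {}) \<and>
     (\<forall>e\<in>edges J. \<forall>f\<in>edges J. e \<noteq> f \<longrightarrow>
        set (internal (pv e)) \<inter> set (internal (pv f)) = {} \<and> set (pe e) \<inter> set (pe f) = {}) \<and>
     verts H = \<phi> ` verts J \<union> (\<Union>e\<in>edges J. set (pv e)) \<and>
     edges H = (\<Union>e\<in>edges J. set (pe e)))"

definition based :: "('v, 'e) ugraph \<Rightarrow> ('w, 'f) ugraph \<Rightarrow> bool" where
  "based J G \<longleftrightarrow> matching_covered G \<and> (\<exists>H. conformal H G \<and> bisubdivision H J)"

lemma multigraph_del_verts: "multigraph G \<Longrightarrow> multigraph (del_verts G X)"
  by (auto simp: multigraph_def del_verts_def)

lemma multigraph_shrink: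
  assumes "multigraph G"
  shows "multigraph (shrink G Y)"
proof -
  let ?f = "\<lambda>v. if v \<in> Y then None else Some v"
  have "?f ` ends G e \<subseteq> ?f ` verts G \<and> card (?f ` ends G e) = 2"
    if e: "e \<in> edges G" "\<not> ends G e \<subseteq> Y" for e
  proof
    have "ends G e \<subseteq> verts G" "card (ends G e) = 2"
      using assms e(1) by (simp_all add: multigraph_def)
    then obtain u v where "ends G e = {u, v}" "u \<noteq> v"
      by (auto simp: card_2_iff)
    then show "card (?f ` ends G e) = 2" using e(2) by (cases "u \<in> Y"; cases "v \<in> Y") simp_all
    show "?f ` ends G e \<subseteq> ?f ` verts G"
      using \<open>ends G e \<subseteq> verts G\<close> by (rule image_mono)
  qed
  moreover have "finite (verts G)" "finite (edges G)"
    using assms by (simp_all add: multigraph_def)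
  ultimately show ?thesis
    unfolding multigraph_def shrink_def Let_def by simp
qed

end

theory Submission imports Defs begin

text \<open>
  Let \<open>H\<close> be a conformal bisubdivision of \<open>J\<close> in \<open>G\<close> and \<open>M0\<close> a perfect matching of \<open>G - V(H)\<close>. If
  \<open>B\<close> is nonempty, every component \<open>L\<close> of \<open>G - B\<close> is odd and every perfect matching of \<open>G\<close> has
  exactly one edge in the cut of \<open>L\<close>. Matchings of \<open>J\<close> lift to \<open>H\<close> and, with \<open>M0\<close>, to \<open>G\<close>; since
  \<open>J - u - v\<close> is matchable for all \<open>u \<noteq> v\<close>, at most one branch vertex lies in \<open>B\<close>.

  A cubic bicritical graph is 3-edge-connected. So if \<open>H\<close> has at most two edges in the cut of \<open>L\<close>,
  then \<open>L\<close> contains all branch vertices or none. A component whose cut is used by \<open>M0\<close> is not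
  crossed by \<open>H\<close>; every other one is crossed at least twice, and there are at least
  \<open>card (B \<inter> V(H))\<close> of those. As vertices of \<open>H\<close> have degree 2, or 3 at the branch vertices, the
  crossings add up to at most \<open>2 card (B \<inter> V(H))\<close>, plus 1 if there is a branch vertex in \<open>B\<close>. Hence
  some \<open>L\<close> contains all branch vertices and is crossed at most twice, or contains all but one and is
  crossed exactly three times. In both cases what lies outside \<open>L\<close> shrinks to an internal vertex of
  one path or to the missing branch vertex, and the matchings show that the paths remain odd.
\<close>

section \<open>Edge cuts and perfect matchings\<close>

text \<open>The edge set is a parameter because cuts of the same vertex set are taken in the whole
  graph, in a matching, in a subgraph and along a single path.\<close>

definition edge_cut :: "('e \<Rightarrow> 'v set) \<Rightarrow> 'e set \<Rightarrow> 'v set \<Rightarrow> 'e set" where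
  "edge_cut d F S = {e \<in> F. d e \<inter> S \<noteq> {} \<and> \<not> d e \<subseteq> S}"

lemma finite_edge_cut [simp]: "finite F \<Longrightarrow> finite (edge_cut d F S)"
  by (simp add: edge_cut_def)

lemma edge_cut_mono: "F \<subseteq> F' \<Longrightarrow> edge_cut d F S \<subseteq> edge_cut d F' S"
  by (auto simp: edge_cut_def)

text \<open>Every vertex of \<open>S\<close> is met by one edge, so \<open>card S\<close> is the sum
  of \<open>card (d e \<inter> S)\<close> over \<open>M\<close>, and a summand is odd, namely 1,
  exactly for an edge of the cut.\<close>

lemma even_card_iff_even_card_cut:
  assumes "finite M" "\<And>e. e \<in> M \<Longrightarrow> card (d e) = 2" "finite S"
    and once: "\<And>v. v \<in> S \<Longrightarrow> \<exists>!e. e \<in> M \<and> v \<in> d e"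
  shows "even (card S) \<longleftrightarrow> even (card (edge_cut d M S))"
proof -
  have "S = (\<Union>e\<in>M. d e \<inter> S)"
    using once by blast
  then have "card S = card (\<Union>e\<in>M. d e \<inter> S)" by simp
  also have "\<dots> = (\<Sum>e\<in>M. card (d e \<inter> S))"
    using assms(1,3) once by (intro card_UN_disjoint) auto
  finally have "even (card S) \<longleftrightarrow> even (card {e \<in> M. odd (card (d e \<inter> S))})"
    using assms(1) by (simp add: even_sum_iff)
  moreover have "{e \<in> M. odd (card (d e \<inter> S))} = edge_cut d M S"
  proof -
    have "odd (card (d e \<inter> S)) \<longleftrightarrow> d e \<inter> S \<noteq> {} \<and> \<not> d e \<subseteq> S" if e: "e \<in> M" for e
    proof -
      obtain x y where "d e = {x, y}" "x \<noteq> y"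
        using assms(2)[OF e] by (auto simp: card_2_iff)
      then show ?thesis by (cases "x \<in> S"; cases "y \<in> S") auto
    qed
    then show ?thesis by (auto simp: edge_cut_def)
  qed
  ultimately show ?thesis by simp
qed

lemma multigraphD:
  assumes "multigraph G"
  shows "finite (verts G)" "finite (edges G)" "\<And>e. e \<in> edges G \<Longrightarrow> ends G e \<subseteq> verts G"
    "\<And>e. e \<in> edges G \<Longrightarrow> card (ends G e) = 2"
  using assms by (auto simp: multigraph_def)

lemma multigraph_edgeE:
  assumes "multigraph G" "e \<in> edges G"
  obtains x y where "ends G e = {x, y}" "x \<noteq> y" "x \<in> verts G" "y \<in> verts G"
proof -
  obtain x y where "ends G e = {x, y}" "x \<noteq> y"
    using multigraphD(4)[OF assms] by (auto simp: card_2_iff)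
  with that show thesis using multigraphD(3)[OF assms] by auto
qed

lemma del_verts_empty [simp]: "del_verts G {} = G"
  by (simp add: del_verts_def)

lemma perfect_matching_del_verts_iff:
  "perfect_matching (del_verts G T) M \<longleftrightarrow>
     M \<subseteq> edges G \<and> (\<forall>e\<in>M. ends G e \<inter> T = {}) \<and>
     (\<forall>v\<in>verts G - T. \<exists>!e. e \<in> M \<and> v \<in> ends G e)"
  by (auto simp: perfect_matching_def del_verts_def)

text \<open>The two matchings cannot interfere: edges of \<open>H\<close> stay inside
  \<open>verts H\<close> and edges of \<open>M\<close> avoid it.\<close>

lemma perfect_matching_Un:
  assumes "subgraph H G" "perfect_matching (del_verts G (verts H)) M" "T \<subseteq> verts H"
    "perfect_matching (del_verts H T) N"
  shows "perfect_matching (del_verts G T) (N \<union> M)"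
proof -
  have H: "edges H \<subseteq> edges G" "ends H = ends G" "multigraph H"
    using assms(1) by (auto simp: subgraph_def)
  have H_ends: "ends G e \<subseteq> verts H" if "e \<in> edges H" for e
    using multigraphD(3)[OF H(3) that] H(2) by simp
  have M: "M \<subseteq> edges G" "\<And>e. e \<in> M \<Longrightarrow> ends G e \<inter> verts H = {}"
    "\<And>v. v \<in> verts G - verts H \<Longrightarrow> \<exists>!e. e \<in> M \<and> v \<in> ends G e"
    using assms(2) by (auto simp: perfect_matching_del_verts_iff)
  have N: "N \<subseteq> edges H" "\<And>e. e \<in> N \<Longrightarrow> ends G e \<inter> T = {}"
    "\<And>v. v \<in> verts H - T \<Longrightarrow> \<exists>!e. e \<in> N \<and> v \<in> ends G e"
    using assms(4) H(2) by (auto simp: perfect_matching_del_verts_iff)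
  have "\<exists>!e. e \<in> N \<union> M \<and> v \<in> ends G e" if v: "v \<in> verts G - T" for v
  proof (cases "v \<in> verts H")
    case True
    then have "e \<in> N \<union> M \<and> v \<in> ends G e \<longleftrightarrow> e \<in> N \<and> v \<in> ends G e" for e
      using M(2)[of e] by auto
    with N(3)[of v] True v show ?thesis by auto
  next
    case False
    then have "e \<in> N \<union> M \<and> v \<in> ends G e \<longleftrightarrow> e \<in> M \<and> v \<in> ends G e" for e
      using H_ends[of e] N(1) by auto
    with M(3)[of v] False v show ?thesis by auto
  qed
  moreover have "\<forall>e\<in>N \<union> M. ends G e \<inter> T = {}"
    using M(2) N(2) assms(3) by blast
  ultimately show ?thesis
    using M(1) N(1) H(1) by (auto simp: perfect_matching_del_verts_iff)
qed

text \<open>Edges of \<open>M\<close> avoid \<open>T\<close>, so \<open>S\<close> and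
  \<open>S - T\<close> have the same cut in \<open>M\<close>.\<close>

lemma even_card_diff_iff_even_card_cut:
  assumes "multigraph G" "perfect_matching (del_verts G T) M" "S \<subseteq> verts G"
  shows "even (card (S - T)) \<longleftrightarrow> even (card (edge_cut (ends G) M S))"
proof -
  have M: "M \<subseteq> edges G" "\<And>e. e \<in> M \<Longrightarrow> ends G e \<inter> T = {}"
    "\<And>v. v \<in> verts G - T \<Longrightarrow> \<exists>!e. e \<in> M \<and> v \<in> ends G e"
    using assms(2) by (auto simp: perfect_matching_del_verts_iff)
  have "edge_cut (ends G) M S = edge_cut (ends G) M (S - T)"
    using M(2) unfolding edge_cut_def by blast
  moreover have "even (card (S - T)) \<longleftrightarrow> even (card (edge_cut (ends G) M (S - T)))"
  proof (rule even_card_iff_even_card_cut)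
    show "finite M" "finite (S - T)"
      using M(1) assms(3) multigraphD(1,2)[OF assms(1)] by (auto intro: finite_subset)
    show "card (ends G e) = 2" if "e \<in> M" for e
      using multigraphD(4)[OF assms(1)] M(1) that by blast
    show "\<exists>!e. e \<in> M \<and> v \<in> ends G e" if "v \<in> S - T" for v
      using M(3)[of v] assms(3) that by blast
  qed
  ultimately show ?thesis by simp
qed

lemma card_matching_edges_at_le:
  assumes "multigraph G" "perfect_matching (del_verts G T) M" "B \<subseteq> verts G"
  shows "card {e \<in> M. ends G e \<inter> B \<noteq> {}} \<le> card (B - T)"
proof (rule card_inj_on_le)
  \<comment> \<open>An edge may have both ends in \<open>B\<close>; choosing one of them gives a map
    into \<open>B - T\<close> that is injective because \<open>M\<close> covers no vertex
    twice.\<close>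
  let ?g = "\<lambda>e. SOME v. v \<in> ends G e \<inter> B"
  have g: "?g e \<in> ends G e \<inter> B" if "ends G e \<inter> B \<noteq> {}" for e
    using that by (metis (no_types, lifting) equals0I someI)
  have M: "\<And>e. e \<in> M \<Longrightarrow> ends G e \<inter> T = {}"
    "\<And>v. v \<in> verts G - T \<Longrightarrow> \<exists>!e. e \<in> M \<and> v \<in> ends G e"
    using assms(2) by (auto simp: perfect_matching_del_verts_iff)
  show im: "?g ` {e \<in> M. ends G e \<inter> B \<noteq> {}} \<subseteq> B - T"
    using g M(1) by blast
  show "inj_on ?g {e \<in> M. ends G e \<inter> B \<noteq> {}}"
  proof (rule inj_onI)
    fix e e' assume e: "e \<in> {e \<in> M. ends G e \<inter> B \<noteq> {}}" "e' \<in> {e \<in> M. ends G e \<inter> B \<noteq> {}}"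
      and eq: "?g e = ?g e'"
    have "?g e \<in> verts G - T" using im e(1) assms(3) by blast
    moreover have "?g e \<in> ends G e" "?g e \<in> ends G e'"
      using g[of e] g[of e'] e eq by auto
    ultimately show "e = e'" using M(2)[of "?g e"] e by blast
  qed
  show "finite (B - T)"
    using assms(3) multigraphD(1)[OF assms(1)] by (auto intro: finite_subset)
qed

section \<open>Components\<close>

text \<open>\<open>component\<close> speaks of maximal connected subgraphs; reachability classes
  describe them explicitly. One reachable end is enough for an edge, since its other end is then
  reachable too.\<close>

definition component_at :: "('v, 'e) ugraph \<Rightarrow> 'v \<Rightarrow> ('v, 'e) ugraph" where
  "component_at G v = \<lparr>verts = {u \<in> verts G. (v, u) \<in> (adj G)\<^sup>*},
     edges = {e \<in> edges G. \<exists>u\<in>ends G e. (v, u) \<in> (adj G)\<^sup>*}, ends = ends G\<rparr>"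

lemma sym_adj: "sym (adj G)"
  by (auto simp: sym_def adj_def insert_commute)

lemma component_at_edge_closed:
  assumes "multigraph G" "e \<in> edges G" "x \<in> ends G e" "(v, x) \<in> (adj G)\<^sup>*" "y \<in> ends G e"
  shows "(v, y) \<in> (adj G)\<^sup>*"
proof -
  obtain a b where "ends G e = {a, b}" using multigraph_edgeE[OF assms(1,2)] .
  then have "(a, b) \<in> adj G" "(b, a) \<in> adj G"
    using assms(2) by (auto simp: adj_def insert_commute)
  with assms(3-5) \<open>ends G e = {a, b}\<close> show ?thesis
    by (auto intro: rtrancl_into_rtrancl)
qed

lemma subgraph_adj_mono: "subgraph K G \<Longrightarrow> adj K \<subseteq> adj G"
  by (auto simp: subgraph_def adj_def)

lemma subgraph_component_at:
  assumes "multigraph G"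
  shows "subgraph (component_at G v) G"
proof -
  have "ends G e \<subseteq> {u \<in> verts G. (v, u) \<in> (adj G)\<^sup>*}"
    if "e \<in> edges G" "x \<in> ends G e" "(v, x) \<in> (adj G)\<^sup>*" for e x
    using component_at_edge_closed[OF assms that] multigraphD(3)[OF assms that(1)] by auto
  then show ?thesis
    using multigraphD[OF assms]
    unfolding subgraph_def multigraph_def component_at_def by simp blast
qed

lemma connected_component_at:
  assumes "multigraph G" "v \<in> verts G"
  shows "connected_graph (component_at G v)"
proof -
  let ?K = "component_at G v"
  have reach: "(v, u) \<in> (adj ?K)\<^sup>*" if "(v, u) \<in> (adj G)\<^sup>*" for u
    using that
  proof (induction rule: rtrancl_induct)
    case (step y z)
    then obtain e where e: "e \<in> edges G" "ends G e = {y, z}"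
      by (auto simp: adj_def)
    then have "e \<in> edges ?K" using step(1) by (auto simp: component_at_def)
    then have "(y, z) \<in> adj ?K" using e by (auto simp: adj_def component_at_def)
    with step.IH show ?case by simp
  qed simp
  have "(u, v) \<in> (adj ?K)\<^sup>*" if "(v, u) \<in> (adj G)\<^sup>*" for u
    using reach[OF that] sym_rtrancl[OF sym_adj[of ?K]] by (auto dest: symD)
  with reach assms(2) show ?thesis
    unfolding connected_graph_def by (auto simp: component_at_def intro: rtrancl_trans)
qed

lemma connected_subgraph_le_component_at:
  assumes "multigraph G" "subgraph K G" "connected_graph K" "v \<in> verts K"
  shows "subgraph K (component_at G v)"
proof -
  have reach: "(v, u) \<in> (adj G)\<^sup>*" if "u \<in> verts K" for u
    using assms(3,4) that rtrancl_mono[OF subgraph_adj_mono[OF assms(2)]]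
    unfolding connected_graph_def by blast
  have "e \<in> edges (component_at G v)" if e: "e \<in> edges K" for e
  proof -
    have K: "multigraph K" "ends K = ends G" "edges K \<subseteq> edges G"
      using assms(2) by (auto simp: subgraph_def)
    obtain x y where "ends K e = {x, y}" "x \<in> verts K"
      using multigraph_edgeE[OF K(1) e] .
    with reach e K show ?thesis by (auto simp: component_at_def)
  qed
  with reach assms(2) show ?thesis
    by (auto simp: subgraph_def component_at_def)
qed

text \<open>A connected subgraph containing the class of \<open>v\<close> contains \<open>v\<close>,
  hence lies within the class by \<open>connected_subgraph_le_component_at\<close>.\<close>

lemma component_component_at:
  assumes "multigraph G" "v \<in> verts G"
  shows "component (component_at G v) G"
  unfolding component_def
proof (intro conjI allI impI)
  show "subgraph (component_at G v) G" using subgraph_component_at[OF assms(1)] .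
  show "connected_graph (component_at G v)" using connected_component_at[OF assms] .
  fix K :: "('a, 'b) ugraph" assume K: "subgraph K G \<and> connected_graph K \<and> subgraph (component_at G v) K"
  have "v \<in> verts (component_at G v)" using assms(2) by (auto simp: component_at_def)
  then have "v \<in> verts K" using K by (auto simp: subgraph_def)
  then have "subgraph K (component_at G v)"
    using K connected_subgraph_le_component_at[OF assms(1)] by blast
  with K show "K = component_at G v" by (auto simp: subgraph_def)
qed

lemma component_eq_component_at:
  assumes "multigraph G" "component L G" "v \<in> verts L"
  shows "L = component_at G v"
proof -
  have "subgraph L G" "connected_graph L" using assms(2) by (auto simp: component_def)
  then have "subgraph L (component_at G v)"
    using connected_subgraph_le_component_at[OF assms(1)] assms(3) by blast
  moreover have "v \<in> verts G" using assms(3) \<open>subgraph L G\<close> by (auto simp: subgraph_def)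
  moreover have "component_at G v = L"
    if "subgraph (component_at G v) G \<and> connected_graph (component_at G v) \<and> subgraph L (component_at G v)"
    using assms(2) that unfolding component_def by blast
  ultimately show ?thesis
    using subgraph_component_at[OF assms(1)] connected_component_at[OF assms(1)] by metis
qed

lemma component_edge_closed:
  assumes "multigraph G" "component L G" "e \<in> edges G" "ends G e \<inter> verts L \<noteq> {}"
  shows "ends G e \<subseteq> verts L"
proof
  fix y assume y: "y \<in> ends G e"
  obtain x where x: "x \<in> ends G e" "x \<in> verts L" using assms(4) by blast
  have "L = component_at G x" using component_eq_component_at[OF assms(1,2) x(2)] .
  moreover have "(x, y) \<in> (adj G)\<^sup>*"
    using component_at_edge_closed[OF assms(1,3) x(1) _ y] by blast
  moreover have "y \<in> verts G" using multigraphD(3)[OF assms(1,3)] y by blast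
  ultimately show "y \<in> verts L" by (auto simp: component_at_def)
qed

lemma component_disjoint:
  assumes "multigraph G" "component L G" "component K G" "L \<noteq> K"
  shows "verts L \<inter> verts K = {}"
proof (rule ccontr)
  assume "verts L \<inter> verts K \<noteq> {}"
  then obtain v where "v \<in> verts L" "v \<in> verts K" by blast
  then show False
    using component_eq_component_at[OF assms(1,2), of v]
      component_eq_component_at[OF assms(1,3), of v] assms(4) by simp
qed

lemma component_subset: "component L G \<Longrightarrow> verts L \<subseteq> verts G"
  by (auto simp: component_def subgraph_def)

lemma component_nonempty: "component L G \<Longrightarrow> verts L \<noteq> {}"
  by (auto simp: component_def connected_graph_def)

lemma finite_Collect_component:
  assumes "multigraph G"
  shows "finite {L. component L G}"
proof -
  have "{L. component L G} \<subseteq> component_at G ` verts G"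
  proof clarify
    fix L assume L: "component L G"
    then obtain v where v: "v \<in> verts L" using component_nonempty by blast
    then have "v \<in> verts G" using component_subset[OF L] by blast
    with component_eq_component_at[OF assms L v] show "L \<in> component_at G ` verts G"
      by (rule image_eqI)
  qed
  then show ?thesis using multigraphD(1)[OF assms] by (meson finite_imageI finite_subset)
qed

text \<open>Reachability leads from \<open>S\<close> to a vertex outside; with an empty cut, no step
  of it could leave \<open>S\<close>.\<close>

lemma connected_cut_nonempty:
  assumes "multigraph G" "connected_graph G" "S \<subseteq> verts G" "S \<noteq> {}" "S \<noteq> verts G"
  shows "edge_cut (ends G) (edges G) S \<noteq> {}"
proof
  assume empty: "edge_cut (ends G) (edges G) S = {}"
  obtain x y where xy: "x \<in> S" "y \<in> verts G - S" using assms(3-5) by blast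
  then have "(x, y) \<in> (adj G)\<^sup>*" using assms(2,3) by (auto simp: connected_graph_def)
  then have "y \<in> S"
  proof (induction rule: rtrancl_induct)
    case (step y z)
    then obtain e where "e \<in> edges G" "ends G e = {y, z}" by (auto simp: adj_def)
    with empty step.IH show ?case by (auto simp: edge_cut_def)
  qed (use xy in simp)
  with xy show False by simp
qed

section \<open>Shrinking\<close>

abbreviation shrink_map :: "'v set \<Rightarrow> 'v \<Rightarrow> 'v option" where
  "shrink_map Y \<equiv> \<lambda>v. if v \<in> Y then None else Some v"

lemma shrink_sel:
  "verts (shrink G Y) = shrink_map Y ` verts G"
  "edges (shrink G Y) = {e \<in> edges G. \<not> ends G e \<subseteq> Y}"
  "ends (shrink G Y) e = shrink_map Y ` ends G e"
  by (simp_all add: shrink_def Let_def)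

lemma connected_shrink:
  assumes "connected_graph G"
  shows "connected_graph (shrink G Y)"
proof -
  let ?f = "shrink_map Y"
  have "(?f u, ?f v) \<in> (adj (shrink G Y))\<^sup>*" if "(u, v) \<in> (adj G)\<^sup>*" for u v
    using that
  proof (induction rule: rtrancl_induct)
    case (step y z)
    then obtain e where e: "e \<in> edges G" "ends G e = {y, z}" by (auto simp: adj_def)
    \<comment> \<open>The edge of a step inside \<open>Y\<close> is discarded, but then both of its
      ends have become \<open>None\<close>.\<close>
    have "?f y = ?f z \<or> (?f y, ?f z) \<in> adj (shrink G Y)"
    proof (cases "{y, z} \<subseteq> Y")
      case False
      then have "e \<in> edges (shrink G Y)" using e by (simp add: shrink_sel)
      moreover have "ends (shrink G Y) e = {?f y, ?f z}" using e by (simp only: shrink_sel) simp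
      ultimately show ?thesis unfolding adj_def by blast
    qed auto
    then show ?case
    proof
      assume "(?f y, ?f z) \<in> adj (shrink G Y)"
      with step.IH show ?thesis by (rule rtrancl.rtrancl_into_rtrancl)
    qed (use step.IH in simp)
  qed simp
  with assms show ?thesis
    unfolding connected_graph_def shrink_sel by (simp only: ball_simps image_is_empty) blast
qed

text \<open>The surviving edges at \<open>None\<close> are those in the cut of \<open>Y\<close>:
  there has to be exactly one in the matching if \<open>None\<close> remains, and none if it is
  deleted. The case \<open>T = {}\<close> serves for matching coverage, the case
  \<open>T = verts H\<close> for conformality.\<close>

lemma perfect_matching_shrink:
  assumes "multigraph G" "perfect_matching (del_verts G T) M"
    and "T \<subseteq> verts G" "Y \<subseteq> verts G"
    and one: "Y \<noteq> {} \<Longrightarrow> T \<inter> Y = {} \<Longrightarrow> card (edge_cut (ends G) M Y) = 1"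
    and zero: "T \<inter> Y \<noteq> {} \<Longrightarrow> edge_cut (ends G) M Y = {}"
  shows "perfect_matching
    (del_verts (shrink G Y) (shrink_map Y ` T)) {e \<in> M. \<not> ends G e \<subseteq> Y}"
    (is "perfect_matching (del_verts _ (?f ` T)) ?M")
proof -
  have M: "M \<subseteq> edges G" "\<And>e. e \<in> M \<Longrightarrow> ends G e \<inter> T = {}"
    "\<And>v. v \<in> verts G - T \<Longrightarrow> \<exists>!e. e \<in> M \<and> v \<in> ends G e"
    using assms(2) by (auto simp: perfect_matching_del_verts_iff)
  have "ends (shrink G Y) e \<inter> ?f ` T = {}" if "e \<in> ?M" for e
  proof -
    \<comment> \<open>Two vertices have the same image if they are equal or both lie in
      \<open>Y\<close>; this excludes the second case, as \<open>e\<close> would cross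
      \<open>Y\<close>.\<close>
    have "\<not> (x \<in> Y \<and> t \<in> Y)" if "x \<in> ends G e" "t \<in> T" for x t
      using zero \<open>e \<in> ?M\<close> that by (auto simp: edge_cut_def)
    with M(2)[of e] that show ?thesis by (auto simp: shrink_sel split: if_splits)
  qed
  moreover have "\<exists>!e. e \<in> ?M \<and> w \<in> ends (shrink G Y) e"
    if w: "w \<in> verts (shrink G Y) - ?f ` T" for w
  proof (cases w)
    case None
    then have "Y \<noteq> {}" "T \<inter> Y = {}" using w by (auto simp: shrink_sel split: if_splits)
    then obtain e0 where "edge_cut (ends G) M Y = {e0}" using one card_1_singletonE by metis
    moreover have "e \<in> ?M \<and> w \<in> ends (shrink G Y) e \<longleftrightarrow> e \<in> edge_cut (ends G) M Y" for e
      using None by (auto simp: shrink_sel edge_cut_def image_iff)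
    ultimately show ?thesis by auto
  next
    case (Some v)
    then have "v \<in> verts G - T" "v \<notin> Y" using w by (auto simp: shrink_sel split: if_splits)
    moreover from this have "e \<in> ?M \<and> w \<in> ends (shrink G Y) e \<longleftrightarrow> e \<in> M \<and> v \<in> ends G e" for e
      using Some by (auto simp: shrink_sel image_iff split: if_splits)
    ultimately show ?thesis using M(3)[of v] by auto
  qed
  moreover have "?M \<subseteq> edges (shrink G Y)"
    using M(1) by (auto simp: shrink_sel)
  ultimately show ?thesis unfolding perfect_matching_del_verts_iff by (intro conjI ballI)
qed

text \<open>A perfect matching of \<open>G\<close> through a surviving edge remains perfect after
  dropping its edges inside \<open>Y\<close>, since it crosses \<open>Y\<close> once.\<close>

lemma matching_covered_shrink:
  assumes "multigraph G" "matching_covered G" "Y \<subset> verts G"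
    and one: "\<And>M. perfect_matching G M \<Longrightarrow> Y \<noteq> {} \<Longrightarrow> card (edge_cut (ends G) M Y) = 1"
  shows "matching_covered (shrink G Y)"
  unfolding matching_covered_def
proof (intro conjI ballI)
  let ?f = "shrink_map Y"
  show "connected_graph (shrink G Y)"
    using assms(2) by (intro connected_shrink) (simp add: matching_covered_def)
  show "card (verts (shrink G Y)) \<ge> 2"
  proof (cases "Y = {}")
    case True
    then show ?thesis
      using assms(2) by (simp add: shrink_sel matching_covered_def card_image)
  next
    case False
    then obtain y z where "y \<in> Y" "y \<in> verts G" "z \<in> verts G" "z \<notin> Y" using assms(3) by blast
    then have "?f ` {y, z} \<subseteq> verts (shrink G Y)" "?f ` {y, z} = {None, Some z}"
      unfolding shrink_sel by (simp_all only: image_mono insert_subset empty_subsetI simp_thms) auto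
    then have "{None, Some z} \<subseteq> verts (shrink G Y)" by metis
    moreover have "finite (verts (shrink G Y))"
      using multigraphD(1)[OF multigraph_shrink[OF assms(1)]] .
    ultimately have "card {None, Some z} \<le> card (verts (shrink G Y))" by (rule card_mono[rotated])
    then show ?thesis by simp
  qed
  fix e assume e: "e \<in> edges (shrink G Y)"
  then obtain M where M: "perfect_matching G M" "e \<in> M"
    using assms(2) by (auto simp: matching_covered_def shrink_sel)
  then have "perfect_matching (shrink G Y) {e \<in> M. \<not> ends G e \<subseteq> Y}"
    using perfect_matching_shrink[OF assms(1), of "{}" M Y] assms(3) one by auto
  with M e show "\<exists>M. perfect_matching (shrink G Y) M \<and> e \<in> M"
    by (auto simp: shrink_sel)
qed

section \<open>Shrinking a walk\<close>

text \<open>The incidence part of \<open>is_path\<close> in recursive form, for inductions along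
  both lists at once.\<close>

fun walk :: "('e \<Rightarrow> 'v set) \<Rightarrow> 'v list \<Rightarrow> 'e list \<Rightarrow> bool" where
  "walk d [v] [] \<longleftrightarrow> True"
| "walk d (u # v # vs) (e # es) \<longleftrightarrow> d e = {u, v} \<and> walk d (v # vs) es"
| "walk d _ _ \<longleftrightarrow> False"

lemma walk_iff_nth:
  "walk d vs es \<longleftrightarrow>
     length vs = Suc (length es) \<and> (\<forall>i<length es. d (es ! i) = {vs ! i, vs ! Suc i})"
  by (induction d vs es rule: walk.induct) (auto simp: All_less_Suc2)

text \<open>The entries \<open>None\<close> stand for the maximal stretches of the walk inside \<open>Y\<close>: each of them is
  bounded by two crossings, except at the two ends of the walk.\<close>

lemma crossings_eq_count_None:
  assumes "walk d vs es"
  shows "length (filter (\<lambda>e. d e \<inter> Y \<noteq> {} \<and> \<not> d e \<subseteq> Y) es) +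
      of_bool (hd vs \<in> Y) + of_bool (last vs \<in> Y) =
    2 * count_list (remdups_adj (map (shrink_map Y) vs)) None"
  using assms
proof (induction d vs es rule: walk.induct)
  case (2 d u v vs e es)
  have e: "d e = {u, v}" and w: "walk d (v # vs) es" using "2.prems" by simp_all
  show ?case
    using "2.IH"[OF w] by (cases "u \<in> Y"; cases "v \<in> Y") (auto simp: e)
qed auto

text \<open>A maximal stretch of \<open>k\<close> vertices inside \<open>Y\<close> has
  \<open>k - 1\<close> edges inside \<open>Y\<close>; summing over the stretches gives the
  count.\<close>

lemma inner_edges_eq_count_None:
  assumes "walk d vs es"
  shows "length (filter (\<lambda>e. d e \<subseteq> Y) es) + count_list (remdups_adj (map (shrink_map Y) vs)) None =
    length (filter (\<lambda>v. v \<in> Y) vs)"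
  using assms
proof (induction d vs es rule: walk.induct)
  case (2 d u v vs e es)
  have e: "d e = {u, v}" and w: "walk d (v # vs) es" using "2.prems" by simp_all
  show ?case
    using "2.IH"[OF w] by (cases "u \<in> Y"; cases "v \<in> Y") (auto simp: e)
qed auto

text \<open>\<open>remdups_adj\<close> contracts the runs of \<open>None\<close>, whose edges are
  those filtered out; distinctness keeps it from merging \<open>Some\<close> entries.\<close>

lemma walk_shrink:
  assumes "walk d vs es" "distinct vs"
  shows "walk (\<lambda>e. shrink_map Y ` d e) (remdups_adj (map (shrink_map Y) vs))
    (filter (\<lambda>e. \<not> d e \<subseteq> Y) es)"
  using assms
proof (induction d vs es rule: walk.induct)
  case (2 d u v vs e es)
  define zs where "zs = tl (remdups_adj (map (shrink_map Y) (v # vs)))"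
  have zs: "remdups_adj (shrink_map Y v # map (shrink_map Y) vs) = shrink_map Y v # zs"
    using remdups_adj_Cons_alt[of "shrink_map Y v" "map (shrink_map Y) vs"] by (simp add: zs_def)
  have e: "d e = {u, v}" "u \<noteq> v" and w: "walk d (v # vs) es" "distinct (v # vs)"
    using "2.prems" by auto
  show ?case
    using "2.IH"[OF w] e zs by (cases "u \<in> Y"; cases "v \<in> Y") auto
qed auto

lemma count_list_remdups_adj_le: "count_list (remdups_adj xs) x \<le> count_list xs x"
  by (induction xs rule: remdups_adj.induct) auto

lemma distinct_if_count_list_le_1: "(\<And>x. count_list xs x \<le> 1) \<Longrightarrow> distinct xs"
proof (induction xs)
  case (Cons y ys)
  have "count_list ys x \<le> 1" for x
    using Cons.prems[of x] by (auto split: if_splits)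
  moreover have "count_list ys y = 0"
    using Cons.prems[of y] by simp
  ultimately show ?case using Cons.IH by (simp add: count_list_0_iff)
qed simp

text \<open>\<open>shrink_map Y\<close> is injective outside \<open>Y\<close>, so
  \<open>None\<close> is the only entry that could occur twice.\<close>

lemma distinct_remdups_adj_shrink_map:
  assumes "distinct vs" "count_list (remdups_adj (map (shrink_map Y) vs)) None \<le> 1"
  shows "distinct (remdups_adj (map (shrink_map Y) vs))"
proof (rule distinct_if_count_list_le_1)
  fix x
  show "count_list (remdups_adj (map (shrink_map Y) vs)) x \<le> 1"
  proof (cases x)
    case (Some v)
    have "count_list (map (shrink_map Y) vs) (Some v) \<le> 1"
      using assms(1) by (induction vs) (auto simp: count_list_0_iff)
    then show ?thesis
      using count_list_remdups_adj_le[of "map (shrink_map Y) vs" x] Some by simp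
  qed (use assms(2) in simp)
qed

section \<open>Internal vertices of a path\<close>

lemma length_internal: "length (internal vs) = length vs - 2"
  by (simp add: internal_def)

lemma in_set_internal_iff: "x \<in> set (internal vs) \<longleftrightarrow> (\<exists>i. 0 < i \<and> Suc i < length vs \<and> x = vs ! i)"
proof -
  have nth: "internal vs ! j = vs ! Suc j" if "j < length vs - 2" for j
    using that by (simp add: internal_def nth_butlast nth_tl)
  show ?thesis
  proof
    assume "x \<in> set (internal vs)"
    then obtain j where "j < length vs - 2" "x = internal vs ! j"
      by (auto simp: in_set_conv_nth length_internal)
    then show "\<exists>i. 0 < i \<and> Suc i < length vs \<and> x = vs ! i"
      using nth[of j] by (intro exI[of _ "Suc j"]) auto
  next
    assume "\<exists>i. 0 < i \<and> Suc i < length vs \<and> x = vs ! i"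
    then obtain j where "Suc (Suc j) < length vs" "x = vs ! Suc j"
      by (metis Suc_pred')
    then show "x \<in> set (internal vs)"
      using nth[of j] by (auto simp: in_set_conv_nth length_internal intro!: exI[of _ j])
  qed
qed

lemma set_internal:
  assumes "distinct vs" "length vs \<ge> 2"
  shows "set (internal vs) = set vs - {hd vs, last vs}"
proof -
  have "vs \<noteq> []" using assms(2) by auto
  then have hl: "hd vs = vs ! 0" "last vs = vs ! (length vs - 1)"
    by (simp_all add: hd_conv_nth last_conv_nth)
  have "x \<in> set (internal vs) \<longleftrightarrow> x \<in> set vs - {hd vs, last vs}" for x
  proof
    assume "x \<in> set (internal vs)"
    then obtain i where i: "0 < i" "Suc i < length vs" "x = vs ! i"
      unfolding in_set_internal_iff by blast
    then have "i < length vs" "0 < length vs" "length vs - 1 < length vs" by linarith+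
    then have "vs ! i \<noteq> vs ! 0" "vs ! i \<noteq> vs ! (length vs - 1)"
      using i nth_eq_iff_index_eq[OF assms(1)] by auto
    then show "x \<in> set vs - {hd vs, last vs}"
      using i by (simp add: hl)
  next
    assume x: "x \<in> set vs - {hd vs, last vs}"
    then obtain i where i: "i < length vs" "x = vs ! i" by (auto simp: in_set_conv_nth)
    then have "0 < i" "i \<noteq> length vs - 1" using x hl by (auto intro: Nat.gr0I)
    with i show "x \<in> set (internal vs)"
      unfolding in_set_internal_iff by (intro exI[of _ i]) auto
  qed
  then show ?thesis by blast
qed

section \<open>Bisubdivisions\<close>

text \<open>The witnesses for \<open>bisubdivision H J\<close> become parameters, so that the paths
  and branch vertices have fixed names.\<close>

locale bisubdivided =
  fixes H :: "('w, 'f) ugraph" and J :: "('v, 'e) ugraph"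
    and \<phi> :: "'v \<Rightarrow> 'w" and pv :: "'e \<Rightarrow> 'w list" and pe :: "'e \<Rightarrow> 'f list"
  assumes multigraph_J: "multigraph J"
    and multigraph_H: "multigraph H"
    and inj_branch: "inj_on \<phi> (verts J)"
    and path: "e \<in> edges J \<Longrightarrow> is_path H (pv e) (pe e)"
    and path_ends: "e \<in> edges J \<Longrightarrow> {hd (pv e), last (pv e)} = \<phi> ` ends J e"
    and even_internal: "e \<in> edges J \<Longrightarrow> even (length (internal (pv e)))"
    and internal_not_branch: "e \<in> edges J \<Longrightarrow> set (internal (pv e)) \<inter> \<phi> ` verts J = {}"
    and internal_disjoint: "e \<in> edges J \<Longrightarrow> e' \<in> edges J \<Longrightarrow> e \<noteq> e' \<Longrightarrow>
      set (internal (pv e)) \<inter> set (internal (pv e')) = {}"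
    and path_edges_disjoint: "e \<in> edges J \<Longrightarrow> e' \<in> edges J \<Longrightarrow> e \<noteq> e' \<Longrightarrow>
      set (pe e) \<inter> set (pe e') = {}"
    and verts_H: "verts H = \<phi> ` verts J \<union> (\<Union>e\<in>edges J. set (pv e))"
    and edges_H: "edges H = (\<Union>e\<in>edges J. set (pe e))"

lemma bisubdivisionE:
  assumes "bisubdivision H J" "multigraph J" "multigraph H"
  obtains \<phi> pv pe where "bisubdivided H J \<phi> pv pe"
  using assms(1) unfolding bisubdivision_def
proof (elim exE conjE)
  fix \<phi> pv pe
  assume *: "inj_on \<phi> (verts J)"
    "\<forall>e\<in>edges J. is_path H (pv e) (pe e) \<and> {hd (pv e), last (pv e)} = \<phi> ` ends J e \<and>
      even (length (internal (pv e))) \<and> set (internal (pv e)) \<inter> \<phi> ` verts J = {}"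
    "\<forall>e\<in>edges J. \<forall>f\<in>edges J. e \<noteq> f \<longrightarrow> set (internal (pv e)) \<inter> set (internal (pv f)) = {} \<and>
      set (pe e) \<inter> set (pe f) = {}"
    "verts H = \<phi> ` verts J \<union> (\<Union>e\<in>edges J. set (pv e))"
    "edges H = (\<Union>e\<in>edges J. set (pe e))"
  have "bisubdivided H J \<phi> pv pe"
  proof
    show "multigraph J" "multigraph H" by (rule assms)+
    show "is_path H (pv e) (pe e)" "{hd (pv e), last (pv e)} = \<phi> ` ends J e"
      "even (length (internal (pv e)))" "set (internal (pv e)) \<inter> \<phi> ` verts J = {}"
      if "e \<in> edges J" for e
      using *(2) that by blast+
    show "set (internal (pv e)) \<inter> set (internal (pv e')) = {}" "set (pe e) \<inter> set (pe e') = {}"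
      if "e \<in> edges J" "e' \<in> edges J" "e \<noteq> e'" for e e'
      using *(3) that by blast+
  qed (rule *)+
  then show thesis by (rule that)
qed

context bisubdivided
begin

text \<open>The ends of \<open>e\<close> have distinct images, so the path has an edge, and an even
  number of internal vertices then makes the number of edges odd.\<close>

lemma
  assumes e: "e \<in> edges J"
  shows walk_path: "walk (ends H) (pv e) (pe e)"
    and length_path: "length (pv e) = Suc (length (pe e))"
    and distinct_path: "distinct (pv e)"
    and hd_neq_last_path: "hd (pv e) \<noteq> last (pv e)"
    and odd_length_path: "odd (length (pe e))"
    and hd_path: "hd (pv e) = pv e ! 0"
    and last_path: "last (pv e) = pv e ! length (pe e)"
proof -
  show walk: "walk (ends H) (pv e) (pe e)" and len: "length (pv e) = Suc (length (pe e))"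
    and "distinct (pv e)"
    using path[OF e] by (auto simp: is_path_def walk_iff_nth)
  obtain x y where "ends J e = {x, y}" "x \<noteq> y" "x \<in> verts J" "y \<in> verts J"
    using multigraph_edgeE[OF multigraph_J e] .
  moreover from this have "\<phi> x \<noteq> \<phi> y" using inj_branch by (auto dest: inj_onD)
  ultimately show neq: "hd (pv e) \<noteq> last (pv e)"
    using path_ends[OF e] by (auto simp: doubleton_eq_iff)
  \<comment> \<open>\<open>length (internal vs)\<close> is the truncated difference
    \<open>length vs - 2\<close>, thus also even for a single vertex.\<close>
  have "pe e \<noteq> []"
  proof
    assume "pe e = []"
    then have "length (pv e) = Suc 0" using len by simp
    with neq show False by (auto simp: length_Suc_conv)
  qed
  then show "odd (length (pe e))"
    using even_internal[OF e] len by (cases "length (pe e)") (auto simp: length_internal)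
  have "pv e \<noteq> []" using len by auto
  then show "hd (pv e) = pv e ! 0" "last (pv e) = pv e ! length (pe e)"
    using len by (simp_all add: hd_conv_nth last_conv_nth)
qed

lemma length_path_pos: "e \<in> edges J \<Longrightarrow> 0 < length (pe e)"
  using odd_length_path[of e] by (auto intro: Nat.gr0I)

lemma ends_path: "e \<in> edges J \<Longrightarrow> i < length (pe e) \<Longrightarrow> ends H (pe e ! i) = {pv e ! i, pv e ! Suc i}"
  using walk_path by (simp add: walk_iff_nth)

lemma path_inner_internal:
  "e \<in> edges J \<Longrightarrow> 0 < i \<Longrightarrow> i < length (pe e) \<Longrightarrow> pv e ! i \<in> set (internal (pv e))"
  by (auto simp: in_set_internal_iff length_path)

lemma path_end_branch:
  assumes "e \<in> edges J" "i = 0 \<or> i = length (pe e)"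
  shows "pv e ! i \<in> \<phi> ` ends J e"
  using path_ends[OF assms(1)] assms(2) hd_path[OF assms(1)] last_path[OF assms(1)] by auto

lemma distinct_path_edges:
  assumes e: "e \<in> edges J"
  shows "distinct (pe e)"
  unfolding distinct_conv_nth
proof (intro allI impI)
  fix i j assume ij: "i < length (pe e)" "j < length (pe e)" "i \<noteq> j"
  have "{pv e ! i, pv e ! Suc i} \<noteq> {pv e ! j, pv e ! Suc j}"
    using ij distinct_path[OF e] length_path[OF e]
    by (auto simp: doubleton_eq_iff nth_eq_iff_index_eq)
  then show "pe e ! i \<noteq> pe e ! j" using ends_path[OF e] ij by metis
qed

lemma edge_of_H_cases:
  assumes "f \<in> edges H"
  obtains e i where "e \<in> edges J" "i < length (pe e)" "f = pe e ! i"
  using assms unfolding edges_H by (auto simp: in_set_conv_nth)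

lemma vert_of_H_cases:
  assumes "x \<in> verts H"
  obtains (branch) v where "v \<in> verts J" "x = \<phi> v"
  | (inner) e j where "e \<in> edges J" "0 < j" "j < length (pe e)" "x = pv e ! j"
proof (cases "x \<in> \<phi> ` verts J")
  case False
  then obtain e where e: "e \<in> edges J" "x \<in> set (pv e)"
    using assms by (auto simp: verts_H)
  then obtain j where j: "j \<le> length (pe e)" "x = pv e ! j"
    using length_path by (auto simp: in_set_conv_nth less_Suc_eq_le)
  have "ends J e \<subseteq> verts J" using multigraphD(3)[OF multigraph_J e(1)] .
  then have "\<not> (j = 0 \<or> j = length (pe e))"
    using path_end_branch[OF e(1), of j] j False by blast
  with inner[OF e(1), of j] j show thesis by auto
qed (use branch in auto)

text \<open>Meaningful only if \<open>v\<close> is an end of \<open>e\<close>.\<close>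

definition end_index :: "'e \<Rightarrow> 'v \<Rightarrow> nat" where
  "end_index e v = (if pv e ! 0 = \<phi> v then 0 else length (pe e) - 1)"

text \<open>In a path with an odd number of edges the first and the last edge both have even
  positions. This is why an alternating choice along the path behaves alike at its two ends.\<close>

lemma even_end_index: "e \<in> edges J \<Longrightarrow> even (end_index e v)"
  using odd_length_path by (simp add: end_index_def)

lemma end_index_less: "e \<in> edges J \<Longrightarrow> end_index e v < length (pe e)"
  using length_path_pos by (simp add: end_index_def)

text \<open>Internal vertices are never branch vertices, so \<open>\<phi> v\<close> can occur only
  at an end of the path, and there only if \<open>v\<close> is an end of \<open>e\<close>.\<close>

lemma branch_in_ends_path_iff:
  assumes e: "e \<in> edges J" and v: "v \<in> verts J" and i: "i < length (pe e)"
  shows "\<phi> v \<in> ends H (pe e ! i) \<longleftrightarrow> v \<in> ends J e \<and> i = end_index e v"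
proof
  have sub: "ends J e \<subseteq> verts J" using multigraphD(3)[OF multigraph_J e] .
  have neq: "pv e ! 0 \<noteq> pv e ! length (pe e)"
    using hd_neq_last_path[OF e] hd_path[OF e] last_path[OF e] by simp
  have end_v: "v \<in> ends J e" if k: "\<phi> v = pv e ! k" "k = 0 \<or> k = length (pe e)" for k
  proof -
    obtain w where w: "w \<in> ends J e" "\<phi> v = \<phi> w"
      using path_end_branch[OF e k(2)] k(1) by auto
    then have "w = v" using inj_onD[OF inj_branch, of v w] sub v by auto
    with w show ?thesis by simp
  qed
  have end_k: "k = 0 \<or> k = length (pe e)" if "\<phi> v = pv e ! k" "k \<le> length (pe e)" for k
  proof (rule ccontr)
    assume "\<not> ?thesis"
    then have "\<phi> v \<in> set (internal (pv e))" using path_inner_internal[OF e, of k] that by auto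
    with internal_not_branch[OF e] v show False by blast
  qed
  {
    assume "\<phi> v \<in> ends H (pe e ! i)"
    then consider "\<phi> v = pv e ! i" | "\<phi> v = pv e ! Suc i" using ends_path[OF e i] by auto
    then show "v \<in> ends J e \<and> i = end_index e v"
    proof cases
      case 1
      then have "i = 0" using end_k[of i] i by auto
      with 1 end_v[of 0] show ?thesis by (simp add: end_index_def)
    next
      case 2
      then have "Suc i = length (pe e)" using end_k[of "Suc i"] i by auto
      with 2 end_v[of "Suc i"] neq show ?thesis by (auto simp: end_index_def)
    qed
  }
  assume *: "v \<in> ends J e \<and> i = end_index e v"
  then have "\<phi> v = pv e ! 0 \<or> \<phi> v = pv e ! length (pe e)"
    using path_ends[OF e] hd_path[OF e] last_path[OF e] by auto
  with * show "\<phi> v \<in> ends H (pe e ! i)"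
    using ends_path[OF e i] length_path_pos[OF e] neq by (auto simp: end_index_def split: if_splits)
qed

text \<open>An internal vertex is private to its path and no branch vertex, so it occurs at position
  \<open>j\<close> of the path of \<open>e\<close> and nowhere else.\<close>

lemma inner_in_ends_path_iff:
  assumes e: "e \<in> edges J" and j: "0 < j" "j < length (pe e)"
    and e': "e' \<in> edges J" and i: "i < length (pe e')"
  shows "pv e ! j \<in> ends H (pe e' ! i) \<longleftrightarrow> e' = e \<and> (i = j \<or> Suc i = j)"
proof
  have *: "e' = e \<and> k = j" if k: "pv e ! j = pv e' ! k" "k \<le> length (pe e')" for k
  proof -
    have x: "pv e ! j \<in> set (internal (pv e))" using path_inner_internal[OF e j] .
    have "ends J e' \<subseteq> verts J" using multigraphD(3)[OF multigraph_J e'] .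
    then have "\<not> (k = 0 \<or> k = length (pe e'))"
      using path_end_branch[OF e', of k] internal_not_branch[OF e] x unfolding k(1) by blast
    then have "pv e ! j \<in> set (internal (pv e'))"
      using path_inner_internal[OF e', of k] k by auto
    then have "e' = e" using internal_disjoint[OF e e'] x by blast
    moreover from this have "k = j"
      using k j distinct_path[OF e] length_path[OF e] by (simp add: nth_eq_iff_index_eq)
    ultimately show ?thesis by simp
  qed
  show "e' = e \<and> (i = j \<or> Suc i = j)" if "pv e ! j \<in> ends H (pe e' ! i)"
    using that ends_path[OF e' i] *[of i] *[of "Suc i"] i by auto
  show "pv e ! j \<in> ends H (pe e' ! i)" if "e' = e \<and> (i = j \<or> Suc i = j)"
    using that ends_path[OF e' i] by auto
qed

section \<open>Lifting matchings of \<open>J\<close> to \<open>H\<close>\<close>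

text \<open>On a path with an odd number of edges, the edges at even positions match all its
  vertices and those at odd positions exactly the internal ones. An edge in \<open>P\<close> turns
  into the first choice, any other edge into the second.\<close>

definition lift_matching :: "'e set \<Rightarrow> 'f set" where
  "lift_matching P = {pe e ! i |e i. e \<in> edges J \<and> i < length (pe e) \<and> (even i \<longleftrightarrow> e \<in> P)}"

lemma nth_mem_lift_matching_iff:
  assumes "e \<in> edges J" "i < length (pe e)"
  shows "pe e ! i \<in> lift_matching P \<longleftrightarrow> (even i \<longleftrightarrow> e \<in> P)"
proof
  assume "pe e ! i \<in> lift_matching P"
  then obtain e' i' where *: "e' \<in> edges J" "i' < length (pe e')" "even i' \<longleftrightarrow> e' \<in> P"
    "pe e ! i = pe e' ! i'"
    by (auto simp: lift_matching_def)
  then have "e' = e" using path_edges_disjoint[OF assms(1) *(1)] assms(2) by (metis disjoint_iff nth_mem)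
  moreover from this have "i' = i"
    using * assms distinct_path_edges[OF assms(1)] by (simp add: nth_eq_iff_index_eq)
  ultimately show "even i \<longleftrightarrow> e \<in> P" using * by simp
next
  assume "even i \<longleftrightarrow> e \<in> P"
  with assms show "pe e ! i \<in> lift_matching P" unfolding lift_matching_def by blast
qed

lemma lift_matching_subset: "lift_matching P \<subseteq> edges H"
  by (auto simp: lift_matching_def edges_H)

lemma perfect_matching_lift:
  assumes T: "T \<subseteq> verts J" and P: "perfect_matching (del_verts J T) P"
  shows "perfect_matching (del_verts H (\<phi> ` T)) (lift_matching P)"
  unfolding perfect_matching_del_verts_iff
proof (intro conjI ballI)
  have P': "P \<subseteq> edges J" "\<And>e. e \<in> P \<Longrightarrow> ends J e \<inter> T = {}"
    "\<And>v. v \<in> verts J - T \<Longrightarrow> \<exists>!e. e \<in> P \<and> v \<in> ends J e"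
    using P by (auto simp: perfect_matching_del_verts_iff)
  show "lift_matching P \<subseteq> edges H" by (rule lift_matching_subset)
  show "ends H f \<inter> \<phi> ` T = {}" if f: "f \<in> lift_matching P" for f
  proof (rule ccontr)
    assume "ends H f \<inter> \<phi> ` T \<noteq> {}"
    then obtain t where t: "t \<in> T" "\<phi> t \<in> ends H f" by blast
    obtain e i where ei: "e \<in> edges J" "i < length (pe e)" "f = pe e ! i"
      using f lift_matching_subset edge_of_H_cases by blast
    then have "t \<in> ends J e" "i = end_index e t"
      using branch_in_ends_path_iff[of e t i] t T by auto
    then have "e \<in> P"
      using f nth_mem_lift_matching_iff[OF ei(1,2)] even_end_index[OF ei(1)] ei(3) by simp
    with P'(2) t \<open>t \<in> ends J e\<close> show False by blast
  qed
  show "\<exists>!f. f \<in> lift_matching P \<and> x \<in> ends H f" if x: "x \<in> verts H - \<phi> ` T" for x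
  proof -
    from x have "x \<in> verts H" by simp
    then show ?thesis
    proof (cases rule: vert_of_H_cases)
      case (branch v)
      then have "v \<in> verts J - T" using x by auto
      then obtain e where e: "e \<in> P" "v \<in> ends J e" and uniq: "\<And>e'. e' \<in> P \<Longrightarrow> v \<in> ends J e' \<Longrightarrow> e' = e"
        using P'(3) by metis
      then have eJ: "e \<in> edges J" using P'(1) by blast
      show ?thesis
      proof (rule ex1I)
        show "pe e ! end_index e v \<in> lift_matching P \<and> x \<in> ends H (pe e ! end_index e v)"
          using nth_mem_lift_matching_iff[OF eJ end_index_less[OF eJ]] even_end_index[OF eJ] e
            branch_in_ends_path_iff[OF eJ branch(1) end_index_less[OF eJ]] branch(2) by simp
        fix f assume f: "f \<in> lift_matching P \<and> x \<in> ends H f"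
        then obtain e' i where ei: "e' \<in> edges J" "i < length (pe e')" "f = pe e' ! i"
          using lift_matching_subset edge_of_H_cases by blast
        then have *: "v \<in> ends J e'" "i = end_index e' v"
          using branch_in_ends_path_iff[of e' v i] branch f by auto
        then have "e' \<in> P"
          using f nth_mem_lift_matching_iff[OF ei(1,2)] even_end_index[OF ei(1)] ei(3) by simp
        with uniq * ei show "f = pe e ! end_index e v" by auto
      qed
    next
      case (inner e j)
      \<comment> \<open>An internal vertex lies on the edges at positions \<open>j - 1\<close> and
        \<open>j\<close>; exactly one of them has the parity prescribed for the path of
        \<open>e\<close>.\<close>
      let ?i = "if even j \<longleftrightarrow> e \<in> P then j else j - 1"
      have i: "?i < length (pe e)" using inner by auto
      show ?thesis
      proof (rule ex1I)
        show "pe e ! ?i \<in> lift_matching P \<and> x \<in> ends H (pe e ! ?i)"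
          using nth_mem_lift_matching_iff[OF inner(1) i] inner
            inner_in_ends_path_iff[OF inner(1-3) inner(1) i] by (auto split: if_splits)
        fix f assume f: "f \<in> lift_matching P \<and> x \<in> ends H f"
        then obtain e' i where ei: "e' \<in> edges J" "i < length (pe e')" "f = pe e' ! i"
          using lift_matching_subset edge_of_H_cases by blast
        then have "e' = e" "i = j \<or> Suc i = j"
          using inner_in_ends_path_iff[OF inner(1-3) ei(1,2)] inner(4) f by auto
        moreover have "even i \<longleftrightarrow> e' \<in> P"
          using f nth_mem_lift_matching_iff[OF ei(1,2)] ei(3) by simp
        ultimately show "f = pe e ! ?i" using ei(3) by auto
      qed
    qed
  qed
qed

text \<open>Edges of \<open>H\<close> at \<open>\<phi> v\<close> are end edges of paths, at most one
  for each edge of \<open>J\<close> at \<open>v\<close>.\<close>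

lemma card_edges_at_branch_le:
  assumes "v \<in> verts J"
  shows "card {f \<in> edges H. \<phi> v \<in> ends H f} \<le> card {e \<in> edges J. v \<in> ends J e}"
proof (rule surj_card_le)
  show "finite {e \<in> edges J. v \<in> ends J e}" using multigraphD(2)[OF multigraph_J] by simp
  show "{f \<in> edges H. \<phi> v \<in> ends H f} \<subseteq>
      (\<lambda>e. pe e ! end_index e v) ` {e \<in> edges J. v \<in> ends J e}"
  proof clarify
    fix f assume f: "f \<in> edges H" "\<phi> v \<in> ends H f"
    then obtain e i where ei: "e \<in> edges J" "i < length (pe e)" "f = pe e ! i"
      using edge_of_H_cases by blast
    with f branch_in_ends_path_iff[of e v i] assms
    show "f \<in> (\<lambda>e. pe e ! end_index e v) ` {e \<in> edges J. v \<in> ends J e}" by auto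
  qed
qed

lemma card_edges_at_inner_le:
  assumes "x \<in> verts H - \<phi> ` verts J"
  shows "card {f \<in> edges H. x \<in> ends H f} \<le> 2"
proof -
  from assms have "x \<in> verts H" by simp
  then obtain e j where ej: "e \<in> edges J" "0 < j" "j < length (pe e)" "x = pv e ! j"
    using assms by (elim vert_of_H_cases) auto
  have "{f \<in> edges H. x \<in> ends H f} \<subseteq> {pe e ! j, pe e ! (j - 1)}"
  proof
    fix f assume "f \<in> {f \<in> edges H. x \<in> ends H f}"
    then have f: "f \<in> edges H" "x \<in> ends H f" by simp_all
    then obtain e' i where ei: "e' \<in> edges J" "i < length (pe e')" "f = pe e' ! i"
      using edge_of_H_cases by blast
    then have "e' = e \<and> (i = j \<or> Suc i = j)"
      using inner_in_ends_path_iff[OF ej(1-3) ei(1,2)] ej(4) f by simp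
    with ei(3) show "f \<in> {pe e ! j, pe e ! (j - 1)}" by auto
  qed
  then have "card {f \<in> edges H. x \<in> ends H f} \<le> card {pe e ! j, pe e ! (j - 1)}"
    by (intro card_mono) auto
  also have "\<dots> \<le> 2" by (simp add: card_insert_if)
  finally show ?thesis .
qed

section \<open>Crossings along the paths\<close>

text \<open>This is the number of maximal stretches of the path inside \<open>Y\<close>.\<close>

definition gaps :: "'w set \<Rightarrow> 'e \<Rightarrow> nat" where
  "gaps Y e = count_list (remdups_adj (map (shrink_map Y) (pv e))) None"

lemma card_cut_path:
  assumes "e \<in> edges J"
  shows "card (edge_cut (ends H) (set (pe e)) Y) + of_bool (hd (pv e) \<in> Y) + of_bool (last (pv e) \<in> Y) =
    2 * gaps Y e"
proof -
  let ?Q = "\<lambda>f. ends H f \<inter> Y \<noteq> {} \<and> \<not> ends H f \<subseteq> Y"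
  have "edge_cut (ends H) (set (pe e)) Y = set (filter ?Q (pe e))"
    by (auto simp: edge_cut_def)
  then have "card (edge_cut (ends H) (set (pe e)) Y) = length (filter ?Q (pe e))"
    using distinct_card[OF distinct_filter[OF distinct_path_edges[OF assms], of ?Q]] by simp
  then show ?thesis
    using crossings_eq_count_None[OF walk_path[OF assms], of Y] by (simp add: gaps_def)
qed

lemma card_cut_H:
  "card (edge_cut (ends H) (edges H) Y) = (\<Sum>e\<in>edges J. card (edge_cut (ends H) (set (pe e)) Y))"
proof -
  have "edge_cut (ends H) (edges H) Y = (\<Union>e\<in>edges J. edge_cut (ends H) (set (pe e)) Y)"
    by (auto simp: edge_cut_def edges_H)
  moreover have "edge_cut (ends H) (set (pe e)) Y \<inter> edge_cut (ends H) (set (pe e')) Y = {}"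
    if "e \<in> edges J" "e' \<in> edges J" "e \<noteq> e'" for e e'
    using path_edges_disjoint[OF that] by (auto simp: edge_cut_def)
  ultimately show ?thesis
    using multigraphD(2)[OF multigraph_J] by (simp add: card_UN_disjoint)
qed

text \<open>The total in \<open>card_cut_path\<close> is even, so the parity depends only on how
  many ends of the path lie in \<open>Y\<close>.\<close>

lemma odd_card_cut_path_iff:
  assumes e: "e \<in> edges J"
  shows "odd (card (edge_cut (ends H) (set (pe e)) Y)) \<longleftrightarrow>
    e \<in> edge_cut (ends J) (edges J) {v \<in> verts J. \<phi> v \<in> Y}"
proof -
  obtain x y where xy: "ends J e = {x, y}" "x \<in> verts J" "y \<in> verts J"
    using multigraph_edgeE[OF multigraph_J e] .
  have "odd (card (edge_cut (ends H) (set (pe e)) Y)) \<longleftrightarrow> (hd (pv e) \<in> Y \<longleftrightarrow> last (pv e) \<notin> Y)"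
  proof -
    have "even (card (edge_cut (ends H) (set (pe e)) Y) + of_bool (hd (pv e) \<in> Y) + of_bool (last (pv e) \<in> Y))"
      using card_cut_path[OF e, of Y] by simp
    then show ?thesis by (cases "hd (pv e) \<in> Y"; cases "last (pv e) \<in> Y") simp_all
  qed
  also have "\<dots> \<longleftrightarrow> (\<phi> x \<in> Y \<longleftrightarrow> \<phi> y \<notin> Y)"
    using path_ends[OF e] xy by (auto simp: doubleton_eq_iff)
  also have "\<dots> \<longleftrightarrow> e \<in> edge_cut (ends J) (edges J) {v \<in> verts J. \<phi> v \<in> Y}"
    using e xy by (auto simp: edge_cut_def)
  finally show ?thesis .
qed

text \<open>A path joining the two sides crosses an odd number of times, so at least once, and
  distinct paths share no edges.\<close>

lemma card_cut_J_le: "card (edge_cut (ends J) (edges J) {v \<in> verts J. \<phi> v \<in> Y}) \<le> card (edge_cut (ends H) (edges H) Y)"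
proof -
  let ?F = "edge_cut (ends J) (edges J) {v \<in> verts J. \<phi> v \<in> Y}"
  have "card ?F = (\<Sum>e\<in>?F. 1)" by simp
  also have "\<dots> \<le> (\<Sum>e\<in>?F. card (edge_cut (ends H) (set (pe e)) Y))"
  proof (rule sum_mono)
    fix e assume "e \<in> ?F"
    then have "odd (card (edge_cut (ends H) (set (pe e)) Y))"
      using odd_card_cut_path_iff[of e Y] by (auto simp: edge_cut_def)
    then show "1 \<le> card (edge_cut (ends H) (set (pe e)) Y)" by (cases "card (edge_cut (ends H) (set (pe e)) Y)") auto
  qed
  also have "\<dots> \<le> card (edge_cut (ends H) (edges H) Y)"
    unfolding card_cut_H using multigraphD(2)[OF multigraph_J]
    by (intro sum_mono2) (auto simp: edge_cut_def)
  finally show ?thesis .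
qed

lemma even_card_cut_H:
  assumes "{v \<in> verts J. \<phi> v \<in> Y} = {} \<or> {v \<in> verts J. \<phi> v \<in> Y} = verts J"
  shows "even (card (edge_cut (ends H) (edges H) Y))"
proof -
  have "edge_cut (ends J) (edges J) {v \<in> verts J. \<phi> v \<in> Y} = {}"
    using assms multigraphD(3)[OF multigraph_J] by (elim disjE) (auto simp: edge_cut_def)
  then have "even (card (edge_cut (ends H) (set (pe e)) Y))" if "e \<in> edges J" for e
    using odd_card_cut_path_iff[OF that, of Y] by blast
  then show ?thesis unfolding card_cut_H by (intro dvd_sum) auto
qed

lemma gaps_eq_0_iff: "gaps Y e = 0 \<longleftrightarrow> set (pv e) \<inter> Y = {}"
  by (auto simp: gaps_def count_list_0_iff split: if_splits)

text \<open>Without crossings, a path with both ends outside \<open>Y\<close> has no stretch inside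
  it.\<close>

lemma verts_H_disjoint:
  assumes "\<phi> ` verts J \<inter> Y = {}" "edge_cut (ends H) (edges H) Y = {}"
  shows "verts H \<inter> Y = {}"
proof -
  have "set (pv e) \<inter> Y = {}" if e: "e \<in> edges J" for e
  proof -
    have "edge_cut (ends H) (set (pe e)) Y = {}"
      using assms(2) e by (auto simp: edge_cut_def edges_H)
    moreover have "hd (pv e) \<in> \<phi> ` verts J" "last (pv e) \<in> \<phi> ` verts J"
      using path_ends[OF e] multigraphD(3)[OF multigraph_J e] by blast+
    then have "hd (pv e) \<notin> Y" "last (pv e) \<notin> Y" using assms(1) by blast+
    ultimately have "gaps Y e = 0" using card_cut_path[OF e, of Y] by simp
    then show ?thesis by (simp add: gaps_eq_0_iff)
  qed
  with assms(1) show ?thesis by (auto simp: verts_H)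
qed

section \<open>Parity of shrunk paths\<close>

text \<open>For \<open>e \<in> P\<close> the lifted matching restricted to the path of
  \<open>e\<close> is a perfect matching of that path, so the parity count for cuts applies to the
  path alone.\<close>

lemma even_card_path_Int_iff:
  assumes e: "e \<in> edges J" and P: "e \<in> P"
  shows "even (card (set (pv e) \<inter> Y)) \<longleftrightarrow>
    even (card (edge_cut (ends H) (lift_matching P \<inter> set (pe e)) Y))"
proof -
  let ?M = "lift_matching P \<inter> set (pe e)"
  have M: "f \<in> ?M \<longleftrightarrow> (\<exists>i<length (pe e). even i \<and> f = pe e ! i)" for f
    using nth_mem_lift_matching_iff[OF e, of _ P] P by (auto simp: in_set_conv_nth)
  have inc: "pv e ! j \<in> ends H (pe e ! i) \<longleftrightarrow> j = i \<or> j = Suc i"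
    if "i < length (pe e)" "j \<le> length (pe e)" for i j
    using that ends_path[OF e] distinct_path[OF e] length_path[OF e]
    by (auto simp: nth_eq_iff_index_eq)
  have "even (card (set (pv e) \<inter> Y)) \<longleftrightarrow> even (card (edge_cut (ends H) ?M (set (pv e) \<inter> Y)))"
  proof (rule even_card_iff_even_card_cut)
    show "card (ends H f) = 2" if "f \<in> ?M" for f
      using that lift_matching_subset multigraphD(4)[OF multigraph_H] by blast
    show "\<exists>!f. f \<in> ?M \<and> x \<in> ends H f" if "x \<in> set (pv e) \<inter> Y" for x
    proof -
      obtain j where j: "j \<le> length (pe e)" "x = pv e ! j"
      proof -
        obtain j where "j < length (pv e)" "pv e ! j = x"
          using \<open>x \<in> set (pv e) \<inter> Y\<close> by (auto simp: in_set_conv_nth)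
        then show thesis using that[of j] length_path[OF e] by simp
      qed
      \<comment> \<open>The even one of the positions \<open>j\<close> and \<open>j - 1\<close>
        carries the matching edge; for even \<open>j\<close> this edge exists because the last
        vertex has an odd position.\<close>
      have "\<exists>i<length (pe e). even i \<and> (j = i \<or> j = Suc i)"
      proof (cases "even j")
        case True
        then have "j \<noteq> length (pe e)" using odd_length_path[OF e] by metis
        with True j(1) show ?thesis by (intro exI[of _ j]) simp
      next
        case False
        then have "j = Suc (j - 1)" "even (j - 1)" by (cases j; simp)+
        with j(1) show ?thesis by (intro exI[of _ "j - 1"]) linarith
      qed
      then obtain i where i: "i < length (pe e)" "even i" "j = i \<or> j = Suc i" by metis
      show ?thesis
      proof (rule ex1I)
        show "pe e ! i \<in> ?M \<and> x \<in> ends H (pe e ! i)"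
          unfolding M j(2) inc[OF i(1) j(1)] using i by blast
        fix f assume f: "f \<in> ?M \<and> x \<in> ends H f"
        then obtain i' where i': "i' < length (pe e)" "even i'" "f = pe e ! i'"
          unfolding M by blast
        then have "j = i' \<or> j = Suc i'" using inc[OF i'(1) j(1)] f j(2) by simp
        then have "i' = i" using i i' by auto
        with i' show "f = pe e ! i" by simp
      qed
    qed
  qed simp_all
  moreover have "ends H f \<subseteq> set (pv e)" if f: "f \<in> ?M" for f
  proof -
    obtain i where "i < length (pe e)" "f = pe e ! i" using f unfolding M by blast
    then show ?thesis using ends_path[OF e, of i] length_path[OF e] by simp
  qed
  then have "edge_cut (ends H) ?M (set (pv e) \<inter> Y) = edge_cut (ends H) ?M Y"
    unfolding edge_cut_def by blast
  ultimately show ?thesis by simp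
qed

text \<open>The discarded edges and the gaps together are as many as the vertices of the path in
  \<open>Y\<close>. Without a gap nothing is discarded; with one gap the matching makes that number
  odd. Either way an even number of edges disappears.\<close>

lemma odd_length_shrunk_path:
  assumes e: "e \<in> edges J" and "gaps Y e \<le> 1"
    and odd: "gaps Y e = 1 \<Longrightarrow>
      \<exists>P. e \<in> P \<and> odd (card (edge_cut (ends H) (lift_matching P \<inter> set (pe e)) Y))"
  shows "odd (length (filter (\<lambda>f. \<not> ends H f \<subseteq> Y) (pe e)))"
proof -
  have "length (filter (\<lambda>v. v \<in> Y) (pv e)) = card (set (filter (\<lambda>v. v \<in> Y) (pv e)))"
    using distinct_path[OF e] by (simp only: distinct_card distinct_filter)
  also have "set (filter (\<lambda>v. v \<in> Y) (pv e)) = set (pv e) \<inter> Y" by auto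
  finally have "length (filter (\<lambda>f. ends H f \<subseteq> Y) (pe e)) + gaps Y e = card (set (pv e) \<inter> Y)"
    using inner_edges_eq_count_None[OF walk_path[OF e], of Y] by (simp add: gaps_def)
  moreover have "gaps Y e = 0 \<Longrightarrow> card (set (pv e) \<inter> Y) = 0"
    by (simp add: gaps_eq_0_iff)
  moreover have "gaps Y e = 1 \<Longrightarrow> odd (card (set (pv e) \<inter> Y))"
    using odd even_card_path_Int_iff[OF e, of _ Y] by blast
  ultimately have "even (length (filter (\<lambda>f. ends H f \<subseteq> Y) (pe e)))"
    using assms(2) by (cases "gaps Y e = 0") (auto simp: le_Suc_eq dest: sym)
  moreover have "length (filter (\<lambda>f. ends H f \<subseteq> Y) (pe e)) +
      length (filter (\<lambda>f. \<not> ends H f \<subseteq> Y) (pe e)) = length (pe e)"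
    by (rule sum_length_filter_compl)
  ultimately show ?thesis using odd_length_path[OF e] by (metis even_add)
qed

section \<open>Shrinking a bisubdivision\<close>

text \<open>The images of the paths work once \<open>None\<close> does no harm: no path visits it
  twice, the lengths stay odd, and if it is internal to a path, it is neither a branch vertex nor
  internal to another path.\<close>

lemma bisubdivision_shrink:
  assumes inj: "inj_on (\<lambda>v. shrink_map Y (\<phi> v)) (verts J)"
    and le: "\<And>e. e \<in> edges J \<Longrightarrow> gaps Y e \<le> 1"
    and odd: "\<And>e. e \<in> edges J \<Longrightarrow> gaps Y e = 1 \<Longrightarrow>
      \<exists>P. e \<in> P \<and> odd (card (edge_cut (ends H) (lift_matching P \<inter> set (pe e)) Y))"
    and no_branch: "\<And>e. e \<in> edges J \<Longrightarrow> gaps Y e = 1 \<Longrightarrow> hd (pv e) \<notin> Y \<Longrightarrow> last (pv e) \<notin> Y \<Longrightarrow>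
      \<phi> ` verts J \<inter> Y = {}"
    and uniq: "\<And>e e'. e \<in> edges J \<Longrightarrow> e' \<in> edges J \<Longrightarrow> gaps Y e = 1 \<Longrightarrow> gaps Y e' = 1 \<Longrightarrow>
      \<phi> ` verts J \<inter> Y = {} \<Longrightarrow> e = e'"
  shows "bisubdivision (shrink H Y) J"
proof -
  let ?f = "shrink_map Y"
  let ?pv = "\<lambda>e. remdups_adj (map ?f (pv e))"
  let ?pe = "\<lambda>e. filter (\<lambda>f. \<not> ends H f \<subseteq> Y) (pe e)"
  have walk: "walk (ends (shrink H Y)) (?pv e) (?pe e)" if e: "e \<in> edges J" for e
    using walk_shrink[OF walk_path[OF e] distinct_path[OF e], of Y]
    by (simp add: shrink_def Let_def)
  have dist: "distinct (?pv e)" if e: "e \<in> edges J" for e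
    using distinct_remdups_adj_shrink_map[OF distinct_path[OF e]] le[OF e] by (simp add: gaps_def)
  have len: "length (?pv e) = Suc (length (?pe e))" if e: "e \<in> edges J" for e
    using walk[OF e] by (simp add: walk_iff_nth)
  have odd_len: "odd (length (?pe e))" if e: "e \<in> edges J" for e
    using odd_length_shrunk_path[OF e le[OF e]] odd[OF e] by blast
  have ne: "pv e \<noteq> []" if "e \<in> edges J" for e
    using length_path[OF that] by auto
  have hd_last: "hd (?pv e) = ?f (hd (pv e))" "last (?pv e) = ?f (last (pv e))"
    if "e \<in> edges J" for e
    using ne[OF that] by (simp_all add: hd_map last_map)
  have internal': "set (internal (?pv e)) = ?f ` set (pv e) - {?f (hd (pv e)), ?f (last (pv e))}"
    if e: "e \<in> edges J" for e
  proof -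
    have "length (?pv e) \<ge> 2" using len[OF e] odd_len[OF e] by (cases "length (?pe e)") auto
    from set_internal[OF dist[OF e] this] show ?thesis
      using hd_last[OF e] by simp
  qed
  \<comment> \<open>The end entries of a shrunk path are the images of the original ends, so an
    internal \<open>Some x\<close> comes from an internal \<open>x\<close>.\<close>
  have Some_internal: "x \<in> set (internal (pv e))"
    if "e \<in> edges J" "Some x \<in> set (internal (?pv e))" for e x
  proof -
    have "length (pv e) \<ge> 2"
      using length_path[OF that(1)] length_path_pos[OF that(1)] by linarith
    from set_internal[OF distinct_path[OF that(1)] this] show ?thesis
      using that(2) unfolding internal'[OF that(1)] by (auto split: if_splits)
  qed
  \<comment> \<open>\<open>None\<close> is internal only if the path enters \<open>Y\<close> between
    two ends outside it.\<close>
  have None_internal: "gaps Y e = 1" "hd (pv e) \<notin> Y" "last (pv e) \<notin> Y" "\<phi> ` verts J \<inter> Y = {}"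
    if e: "e \<in> edges J" and None: "None \<in> set (internal (?pv e))" for e
  proof -
    have None': "None \<in> ?f ` set (pv e)" "None \<noteq> ?f (hd (pv e))" "None \<noteq> ?f (last (pv e))"
      using None unfolding internal'[OF e] by blast+
    then have "set (pv e) \<inter> Y \<noteq> {}" by (auto split: if_splits)
    then show "gaps Y e = 1" using le[OF e] gaps_eq_0_iff[of Y e] by linarith
    moreover show "hd (pv e) \<notin> Y" "last (pv e) \<notin> Y" using None' by auto
    ultimately show "\<phi> ` verts J \<inter> Y = {}" by (rule no_branch[OF e])
  qed
  have path': "is_path (shrink H Y) (?pv e) (?pe e)" if e: "e \<in> edges J" for e
  proof -
    have "set (?pv e) \<subseteq> verts (shrink H Y)" "set (?pe e) \<subseteq> edges (shrink H Y)"
      using e by (auto simp: shrink_sel verts_H edges_H)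
    with walk[OF e] dist[OF e] show ?thesis by (simp add: is_path_def walk_iff_nth)
  qed
  have ends': "{hd (?pv e), last (?pv e)} = (\<lambda>v. ?f (\<phi> v)) ` ends J e" if e: "e \<in> edges J" for e
  proof -
    have "{hd (?pv e), last (?pv e)} = ?f ` {hd (pv e), last (pv e)}" using hd_last[OF e] by simp
    also have "\<dots> = ?f ` \<phi> ` ends J e" using path_ends[OF e] by simp
    finally show ?thesis by (simp only: image_image)
  qed
  have even': "even (length (internal (?pv e)))" if e: "e \<in> edges J" for e
    using len[OF e] odd_len[OF e] by (cases "length (?pe e)") (auto simp: length_internal)
  have branch': "set (internal (?pv e)) \<inter> (\<lambda>v. ?f (\<phi> v)) ` verts J = {}" if e: "e \<in> edges J" for e
  proof (rule ccontr)
    assume "\<not> ?thesis"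
    then obtain v where v: "v \<in> verts J" "?f (\<phi> v) \<in> set (internal (?pv e))" by blast
    show False
    proof (cases "\<phi> v \<in> Y")
      case True
      then show False using None_internal(4)[OF e] v by auto
    next
      case False
      then show False using Some_internal[OF e, of "\<phi> v"] internal_not_branch[OF e] v by auto
    qed
  qed
  have internal_disjoint': "set (internal (?pv e)) \<inter> set (internal (?pv e')) = {}"
    if e: "e \<in> edges J" "e' \<in> edges J" "e \<noteq> e'" for e e'
  proof (rule ccontr)
    assume "\<not> ?thesis"
    then obtain x where x: "x \<in> set (internal (?pv e))" "x \<in> set (internal (?pv e'))" by blast
    show False
    proof (cases x)
      case None
      with x have "None \<in> set (internal (?pv e))" "None \<in> set (internal (?pv e'))" by simp_all
      then show False
        using uniq[OF e(1,2)] None_internal(1,4)[OF e(1)] None_internal(1)[OF e(2)] e(3) by metis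
    next
      case (Some y)
      then have "y \<in> set (internal (pv e))" "y \<in> set (internal (pv e'))"
        using Some_internal[OF e(1), of y] Some_internal[OF e(2), of y] x by simp_all
      then show False using internal_disjoint[OF e] by blast
    qed
  qed
  have edges_disjoint': "set (?pe e) \<inter> set (?pe e') = {}"
    if e: "e \<in> edges J" "e' \<in> edges J" "e \<noteq> e'" for e e'
    using path_edges_disjoint[OF e] by auto
  have verts': "verts (shrink H Y) = (\<lambda>v. ?f (\<phi> v)) ` verts J \<union> (\<Union>e\<in>edges J. set (?pv e))"
    by (simp only: shrink_sel(1) verts_H image_Un image_UN image_image remdups_adj_set set_map)
  have edges': "edges (shrink H Y) = (\<Union>e\<in>edges J. set (?pe e))"
    by (auto simp: shrink_sel edges_H)
  show ?thesis
    unfolding bisubdivision_def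
    by (intro exI[of _ "\<lambda>v. ?f (\<phi> v)"] exI[of _ ?pv] exI[of _ ?pe] conjI ballI impI)
      (rule inj path' ends' even' branch' internal_disjoint' edges_disjoint' verts' edges';
        assumption?)+
qed

text \<open>Every gap costs two crossings, so at most one path has a gap, and there the shrunk set
  becomes an internal vertex. When \<open>H\<close> does not cross \<open>Y\<close>, the condition
  \<open>cover\<close> is vacuous.\<close>

lemma bisubdivision_shrink_no_branch:
  assumes disj: "\<phi> ` verts J \<inter> Y = {}"
    and le2: "card (edge_cut (ends H) (edges H) Y) \<le> 2"
    and cover: "\<And>e. e \<in> edges J \<Longrightarrow> edge_cut (ends H) (edges H) Y \<noteq> {} \<Longrightarrow>
      \<exists>P. e \<in> P \<and> card (edge_cut (ends H) (lift_matching P) Y) = 1"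
  shows "bisubdivision (shrink H Y) J"
proof -
  have fin: "finite (edges J)" using multigraphD(2)[OF multigraph_J] .
  have gaps: "card (edge_cut (ends H) (set (pe e)) Y) = 2 * gaps Y e" if e: "e \<in> edges J" for e
  proof -
    have "hd (pv e) \<in> \<phi> ` verts J" "last (pv e) \<in> \<phi> ` verts J"
      using path_ends[OF e] multigraphD(3)[OF multigraph_J e] by blast+
    then have "hd (pv e) \<notin> Y" "last (pv e) \<notin> Y" using disj by blast+
    then show ?thesis using card_cut_path[OF e, of Y] by simp
  qed
  have sum_le: "(\<Sum>e\<in>edges J. gaps Y e) \<le> 1"
  proof -
    have "card (edge_cut (ends H) (edges H) Y) = 2 * (\<Sum>e\<in>edges J. gaps Y e)"
      by (simp add: card_cut_H gaps sum_distrib_left)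
    with le2 show ?thesis by simp
  qed
  have le: "gaps Y e \<le> 1" if "e \<in> edges J" for e
    using member_le_sum[of e "edges J" "gaps Y"] that fin sum_le by simp
  have uniq: "e = e'" if "e \<in> edges J" "e' \<in> edges J" "gaps Y e = 1" "gaps Y e' = 1" for e e'
  proof (rule ccontr)
    assume "e \<noteq> e'"
    then have "2 = (\<Sum>e\<in>{e, e'}. gaps Y e)" using that by simp
    also have "\<dots> \<le> (\<Sum>e\<in>edges J. gaps Y e)" using that fin by (intro sum_mono2) auto
    finally show False using sum_le by simp
  qed
  show ?thesis
  proof (rule bisubdivision_shrink)
    have "shrink_map Y (\<phi> v) = Some (\<phi> v)" if "v \<in> verts J" for v
      using disj that by auto
    then show "inj_on (\<lambda>v. shrink_map Y (\<phi> v)) (verts J)"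
      using inj_branch by (auto simp: inj_on_def)
    show "\<exists>P. e \<in> P \<and> odd (card (edge_cut (ends H) (lift_matching P \<inter> set (pe e)) Y))"
      if e: "e \<in> edges J" "gaps Y e = 1" for e
    proof -
      have "edge_cut (ends H) (set (pe e)) Y \<noteq> {}" using gaps[OF e(1)] e(2) by auto
      then have "edge_cut (ends H) (edges H) Y \<noteq> {}" using e(1) by (auto simp: edge_cut_def edges_H)
      then obtain P where P: "e \<in> P" "card (edge_cut (ends H) (lift_matching P) Y) = 1"
        using cover[OF e(1)] by blast
      \<comment> \<open>No other path crosses, so the single crossing of the lifted matching lies on
        the path of \<open>e\<close>.\<close>
      have "edge_cut (ends H) (set (pe e')) Y = {}" if e': "e' \<in> edges J" "e' \<noteq> e" for e'
      proof -
        have "gaps Y e' = 0" using uniq[OF e'(1) e(1)] e(2) e'(2) le[OF e'(1)] by linarith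
        then have "card (edge_cut (ends H) (set (pe e')) Y) = 0" using gaps[OF e'(1)] by simp
        then show ?thesis by simp
      qed
      then have "edge_cut (ends H) (lift_matching P) Y \<subseteq> set (pe e)"
        using lift_matching_subset[of P] unfolding edge_cut_def edges_H by blast
      then have "edge_cut (ends H) (lift_matching P \<inter> set (pe e)) Y = edge_cut (ends H) (lift_matching P) Y"
        by (auto simp: edge_cut_def)
      with P show ?thesis by auto
    qed
  qed (use le uniq disj in auto)
qed

text \<open>Each path at \<open>u\<close> crosses an odd number of times. The bound by the degree of
  \<open>u\<close> thus allows one crossing for each of them and none for other paths, and
  \<open>None\<close> becomes the image of \<open>u\<close>.\<close>

lemma bisubdivision_shrink_one_branch:
  assumes u: "{v \<in> verts J. \<phi> v \<in> Y} = {u}"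
    and le: "card (edge_cut (ends H) (edges H) Y) \<le> card {e \<in> edges J. u \<in> ends J e}"
    and P: "\<And>e. e \<in> P \<Longrightarrow> u \<notin> ends J e" "edge_cut (ends H) (lift_matching P) Y = {}"
  shows "bisubdivision (shrink H Y) J"
proof -
  let ?c = "\<lambda>e. card (edge_cut (ends H) (set (pe e)) Y)"
  have Y: "\<phi> v \<in> Y \<longleftrightarrow> v = u" if "v \<in> verts J" for v
    using u that by (metis (mono_tags, lifting) mem_Collect_eq singleton_iff)
  have fin: "finite (edges J)" using multigraphD(2)[OF multigraph_J] .
  have "edge_cut (ends J) (edges J) {u} = {e \<in> edges J. u \<in> ends J e}"
  proof -
    have "\<not> ends J e \<subseteq> {u}" if "e \<in> edges J" for e
      using card_mono[of "{u}" "ends J e"] multigraphD(4)[OF multigraph_J that] by auto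
    then show ?thesis by (auto simp: edge_cut_def)
  qed
  then have odd_iff: "odd (?c e) \<longleftrightarrow> u \<in> ends J e" if "e \<in> edges J" for e
    using odd_card_cut_path_iff[OF that, of Y] that unfolding u by blast
  have c: "?c e = of_bool (u \<in> ends J e)" if e: "e \<in> edges J" for e
  proof -
    have ge: "of_bool (u \<in> ends J e) \<le> ?c e" if "e \<in> edges J" for e
      using odd_iff[OF that] by (cases "?c e") auto
    have "(\<Sum>e\<in>edges J. ?c e) \<le> (\<Sum>e\<in>edges J. of_bool (u \<in> ends J e))"
      using le fin unfolding card_cut_H by (simp add: sum_of_bool_eq Int_def)
    moreover have "(\<Sum>e\<in>edges J. of_bool (u \<in> ends J e)) < (\<Sum>e\<in>edges J. ?c e)"
      if "?c e \<noteq> of_bool (u \<in> ends J e)"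
    proof (rule sum_strict_mono_ex1)
      show "\<exists>a\<in>edges J. of_bool (u \<in> ends J a) < ?c a"
        using ge[OF e] that e by (metis le_neq_implies_less)
    qed (use fin ge in auto)
    ultimately show ?thesis by linarith
  qed
  have ends: "hd (pv e) \<in> Y \<or> last (pv e) \<in> Y \<longleftrightarrow> u \<in> ends J e" "gaps Y e = of_bool (u \<in> ends J e)"
    if e: "e \<in> edges J" for e
  proof -
    have sub: "ends J e \<subseteq> verts J" using multigraphD(3)[OF multigraph_J e] .
    have "hd (pv e) \<in> Y \<or> last (pv e) \<in> Y \<longleftrightarrow> (\<exists>x\<in>{hd (pv e), last (pv e)}. x \<in> Y)" by simp
    also have "\<dots> \<longleftrightarrow> (\<exists>v\<in>ends J e. \<phi> v \<in> Y)" unfolding path_ends[OF e] by simp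
    also have "\<dots> \<longleftrightarrow> u \<in> ends J e"
      using sub Y[of u] Y by (metis subsetD)
    finally show *: "hd (pv e) \<in> Y \<or> last (pv e) \<in> Y \<longleftrightarrow> u \<in> ends J e" .
    show "gaps Y e = of_bool (u \<in> ends J e)"
      using card_cut_path[OF e, of Y] c[OF e] *
      by (cases "hd (pv e) \<in> Y"; cases "last (pv e) \<in> Y"; cases "u \<in> ends J e") auto
  qed

  show ?thesis
  proof (rule bisubdivision_shrink)
    show "inj_on (\<lambda>v. shrink_map Y (\<phi> v)) (verts J)"
      using inj_branch by (auto simp: inj_on_def Y split: if_splits)
    show "\<exists>P. e \<in> P \<and> odd (card (edge_cut (ends H) (lift_matching P \<inter> set (pe e)) Y))"
      if e: "e \<in> edges J" "gaps Y e = 1" for e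
    proof -
      have "u \<in> ends J e" using ends(2)[OF e(1)] e(2) by (cases "u \<in> ends J e") simp_all
      then have "e \<notin> P" "?c e = 1" using P(1) c[OF e(1)] by auto
      \<comment> \<open>Here \<open>{e}\<close> just selects the even positions on the path of
        \<open>e\<close>. The crossing edge has an even position because \<open>P\<close> avoids
        \<open>e\<close> and its lift, which takes the odd positions there, crosses nothing.\<close>
      have "edge_cut (ends H) (lift_matching {e} \<inter> set (pe e)) Y = edge_cut (ends H) (set (pe e)) Y"
      proof
        show "edge_cut (ends H) (set (pe e)) Y \<subseteq> edge_cut (ends H) (lift_matching {e} \<inter> set (pe e)) Y"
        proof
          fix f assume f: "f \<in> edge_cut (ends H) (set (pe e)) Y"
          then obtain i where i: "i < length (pe e)" "f = pe e ! i"
            by (auto simp: edge_cut_def in_set_conv_nth)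
          have "f \<notin> lift_matching P" using f P(2) by (auto simp: edge_cut_def)
          then have "f \<in> lift_matching {e}"
            using nth_mem_lift_matching_iff[OF e(1) i(1)] \<open>e \<notin> P\<close> i(2) by auto
          with f show "f \<in> edge_cut (ends H) (lift_matching {e} \<inter> set (pe e)) Y"
            by (auto simp: edge_cut_def)
        qed
      qed (auto simp: edge_cut_def)
      then have "odd (card (edge_cut (ends H) (lift_matching {e} \<inter> set (pe e)) Y))"
        using \<open>?c e = 1\<close> by simp
      then show ?thesis by blast
    qed
    show "gaps Y e \<le> 1" if "e \<in> edges J" for e using ends(2)[OF that] by simp
    show "\<phi> ` verts J \<inter> Y = {}" if "e \<in> edges J" "gaps Y e = 1" "hd (pv e) \<notin> Y" "last (pv e) \<notin> Y" for e
      using ends[OF that(1)] that by simp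
    show "e = e'" if "\<phi> ` verts J \<inter> Y = {}" for e e'
      using that u by (metis (mono_tags, lifting) disjoint_iff image_eqI insertI1 mem_Collect_eq)
  qed
qed

end

section \<open>Cubic bicritical graphs\<close>

text \<open>A perfect matching of \<open>J\<close> minus the two ends of \<open>e\<close> is
  completed by \<open>e\<close> itself.\<close>

lemma perfect_matching_containing:
  assumes "multigraph J" "bicritical J" "e \<in> edges J"
  obtains P where "perfect_matching J P" "e \<in> P"
proof -
  obtain x y where xy: "ends J e = {x, y}" "x \<noteq> y" "x \<in> verts J" "y \<in> verts J"
    using multigraph_edgeE[OF assms(1,3)] .
  then obtain M where M: "perfect_matching (del_verts J {x, y}) M"
    using assms(2) unfolding bicritical_def matchable_def by blast
  then have M': "M \<subseteq> edges J" "\<And>f. f \<in> M \<Longrightarrow> ends J f \<inter> {x, y} = {}"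
    "\<And>v. v \<in> verts J - {x, y} \<Longrightarrow> \<exists>!f. f \<in> M \<and> v \<in> ends J f"
    by (auto simp: perfect_matching_del_verts_iff)
  have "\<exists>!f. f \<in> insert e M \<and> v \<in> ends J f" if v: "v \<in> verts J" for v
  proof (cases "v \<in> {x, y}")
    case True
    then have "f \<in> insert e M \<and> v \<in> ends J f \<longleftrightarrow> f = e" for f
      using M'(2)[of f] xy(1) by auto
    then show ?thesis by simp
  next
    case False
    then have "f \<in> insert e M \<and> v \<in> ends J f \<longleftrightarrow> f \<in> M \<and> v \<in> ends J f" for f
      using xy(1) by auto
    with M'(3)[of v] v False show ?thesis by simp
  qed
  then have "perfect_matching J (insert e M)"
    using M'(1) assms(3) by (auto simp: perfect_matching_def)
  then show thesis using that by blast
qed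

text \<open>A perfect matching through another edge at an end of \<open>e\<close> cannot contain
  \<open>e\<close>; degree three provides such an edge.\<close>

lemma perfect_matching_avoiding:
  assumes "multigraph J" "bicritical J" "cubic J" "e \<in> edges J"
  obtains P where "perfect_matching J P" "e \<notin> P"
proof -
  obtain x y where xy: "ends J e = {x, y}" "x \<noteq> y" "x \<in> verts J" "y \<in> verts J"
    using multigraph_edgeE[OF assms(1,4)] .
  have card3: "card {f \<in> edges J. x \<in> ends J f} = 3" using assms(3) xy(3) by (simp add: cubic_def)
  have "\<not> {f \<in> edges J. x \<in> ends J f} \<subseteq> {e}"
  proof
    assume "{f \<in> edges J. x \<in> ends J f} \<subseteq> {e}"
    from card_mono[OF _ this] card3 show False by simp
  qed
  then obtain f where f: "f \<in> edges J" "x \<in> ends J f" "f \<noteq> e" by blast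
  obtain P where P: "perfect_matching J P" "f \<in> P"
    using perfect_matching_containing[OF assms(1,2) f(1)] .
  then have "\<exists>!g. g \<in> P \<and> x \<in> ends J g" using xy(3) by (simp add: perfect_matching_def)
  then have "e \<notin> P" using P(2) f xy(1) by blast
  with P(1) show thesis by (rule that)
qed

text \<open>If the cut of \<open>X\<close> has at most two edges, it can be destroyed by deleting two vertices such
  that an odd number of vertices of \<open>X\<close> remain.\<close>

lemma bicritical_cubic_card_cut_ge_3:
  assumes J: "multigraph J" "bicritical J" "cubic J"
    and X: "X \<subseteq> verts J" "X \<noteq> {}" "X \<noteq> verts J"
  shows "3 \<le> card (edge_cut (ends J) (edges J) X)"
proof (rule ccontr)
  let ?F = "edge_cut (ends J) (edges J) X"
  assume "\<not> 3 \<le> card ?F"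
  have finX: "finite X" using X(1) multigraphD(1)[OF J(1)] by (rule finite_subset)
  \<comment> \<open>If \<open>u\<close> and \<open>v\<close> hit every cut edge, a perfect matching
    of \<open>J - u - v\<close> has no edge in the cut, so an even number of vertices of
    \<open>X\<close> would have to remain.\<close>
  have contra: False
    if uv: "u \<in> verts J" "v \<in> verts J" "u \<noteq> v" "odd (card (X - {u, v}))"
      "\<And>f. f \<in> ?F \<Longrightarrow> u \<in> ends J f \<or> v \<in> ends J f" for u v
  proof -
    obtain M where M: "perfect_matching (del_verts J {u, v}) M"
      using J(2) uv(1-3) unfolding bicritical_def matchable_def by blast
    then have "M \<subseteq> edges J" "\<And>f. f \<in> M \<Longrightarrow> ends J f \<inter> {u, v} = {}"
      by (auto simp: perfect_matching_del_verts_iff)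
    then have "edge_cut (ends J) M X = {}"
      using uv(5) unfolding edge_cut_def by blast
    then show False
      using even_card_diff_iff_even_card_cut[OF J(1) M X(1)] uv(4) by simp
  qed
  have cutE: "\<exists>a b. ends J f = {a, b} \<and> a \<in> X \<and> b \<in> verts J - X" if "f \<in> ?F" for f
  proof -
    have f: "f \<in> edges J" "ends J f \<inter> X \<noteq> {}" "\<not> ends J f \<subseteq> X"
      using that by (auto simp: edge_cut_def)
    obtain x y where "ends J f = {x, y}" "x \<in> verts J" "y \<in> verts J"
      using multigraph_edgeE[OF J(1) f(1)] .
    then show ?thesis using f by (cases "x \<in> X") auto
  qed
  \<comment> \<open>\<open>p\<close>, \<open>q\<close> are the inner and outer end of one cut edge
    and \<open>p'\<close>, \<open>q'\<close> those of the other; with fewer than two cut edges the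
    pairs are arbitrary or may coincide.\<close>
  have "\<exists>p q p' q'. p \<in> X \<and> p' \<in> X \<and> q \<in> verts J - X \<and> q' \<in> verts J - X \<and>
    (\<forall>f\<in>?F. {p, q} \<subseteq> ends J f \<or> {p', q'} \<subseteq> ends J f)"
  proof -
    obtain x0 y0 where xy0: "x0 \<in> X" "y0 \<in> verts J - X" using X by blast
    have finF: "finite ?F" using multigraphD(2)[OF J(1)] by simp
    consider "?F = {}" | f where "?F = {f}" | f g where "?F = {f, g}"
      using \<open>\<not> 3 \<le> card ?F\<close> finF
      by (metis One_nat_def Suc_1 card_0_eq card_1_singletonE card_2_iff less_2_cases_iff
        linorder_not_le numeral_3_eq_3 less_Suc_eq)
    then show ?thesis
    proof cases
      case 1
      then show ?thesis using xy0 by blast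
    next
      case (2 f)
      then obtain a b where "ends J f = {a, b}" "a \<in> X" "b \<in> verts J - X" using cutE by blast
      with 2 show ?thesis by (intro exI[of _ a] exI[of _ b]) simp
    next
      case (3 f g)
      then obtain a b where ab: "ends J f = {a, b}" "a \<in> X" "b \<in> verts J - X" using cutE by blast
      obtain c d where cd: "ends J g = {c, d}" "c \<in> X" "d \<in> verts J - X" using cutE 3 by blast
      show ?thesis
        using 3 ab cd by (intro exI[of _ a] exI[of _ b] exI[of _ c] exI[of _ d]) simp
    qed
  qed
  then obtain p q p' q' where pq: "p \<in> X" "p' \<in> X" "q \<in> verts J - X" "q' \<in> verts J - X"
    "\<And>f. f \<in> ?F \<Longrightarrow> {p, q} \<subseteq> ends J f \<or> {p', q'} \<subseteq> ends J f" by metis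
  show False
  proof (cases "even (card X)")
    case True
    \<comment> \<open>The inner end of one edge and the outer end of the other hit both edges, but
      only one vertex is taken from \<open>X\<close>.\<close>
    have "X - {p, q'} = X - {p}" using pq(4) by blast
    moreover have "card X \<noteq> 0" using pq(1) finX by auto
    ultimately have "odd (card (X - {p, q'}))" using True pq(1) finX by simp
    moreover have "p \<noteq> q'" "p \<in> verts J" "q' \<in> verts J" using pq X(1) by blast+
    moreover have "p \<in> ends J f \<or> q' \<in> ends J f" if "f \<in> ?F" for f using pq(5)[OF that] by auto
    ultimately show False using contra[of p q'] by blast
  next
    case False
    \<comment> \<open>Both deleted vertices are now taken inside \<open>X\<close>, which therefore
      needs a second vertex; a single one would have three cut edges. If \<open>p'\<close> equals
      \<open>p\<close>, any other vertex of \<open>X\<close> replaces it.\<close>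
    have "X \<noteq> {p}"
    proof
      assume "X = {p}"
      have "\<not> ends J f \<subseteq> {p}" if "f \<in> edges J" for f
        using card_mono[of "{p}" "ends J f"] multigraphD(4)[OF J(1) that] by auto
      then have "?F = {f \<in> edges J. p \<in> ends J f}"
        unfolding \<open>X = {p}\<close> by (auto simp: edge_cut_def)
      then have "card ?F = 3" using J(3) pq(1) X(1) by (auto simp: cubic_def)
      with \<open>\<not> 3 \<le> card ?F\<close> show False by simp
    qed
    then obtain r where r: "r \<in> X" "r \<noteq> p" using pq(1) by blast
    define s where "s = (if p' = p then r else p')"
    have s: "s \<in> X" "s \<noteq> p" using r pq(2) by (auto simp: s_def)
    have "X - {p, s} = (X - {p}) - {s}" by blast
    then have "card (X - {p, s}) = card X - 2" using s pq(1) finX by simp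
    moreover have "card X \<ge> 2"
      using card_mono[OF finX, of "{p, s}"] s pq(1) by simp
    ultimately have "odd (card (X - {p, s}))" using False by simp
    moreover have "p \<noteq> s" "p \<in> verts J" "s \<in> verts J" using pq s X(1) by blast+
    moreover have "p \<in> ends J f \<or> s \<in> ends J f" if "f \<in> ?F" for f
      using pq(5)[OF that] by (auto simp: s_def)
    ultimately show False using contra[of p s] by blast
  qed
qed

lemma cubic_card_verts_ge_2:
  assumes "multigraph J" "cubic J" "verts J \<noteq> {}"
  shows "2 \<le> card (verts J)"
proof -
  obtain v where "v \<in> verts J" using assms(3) by blast
  then have "card {e \<in> edges J. v \<in> ends J e} = 3" using assms(2) by (simp add: cubic_def)
  then have "{e \<in> edges J. v \<in> ends J e} \<noteq> {}" by (metis card.empty zero_neq_numeral)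
  then obtain e where e: "e \<in> edges J" by blast
  from card_mono[OF multigraphD(1)[OF assms(1)] multigraphD(3)[OF assms(1) e]]
  show ?thesis using multigraphD(4)[OF assms(1) e] by simp
qed

section \<open>Barriers\<close>

lemma edge_cut_compl:
  assumes "\<And>e. e \<in> F \<Longrightarrow> d e \<subseteq> V"
  shows "edge_cut d F (V - S) = edge_cut d F S"
  using assms unfolding edge_cut_def by blast

lemma component_cut_meets:
  assumes "multigraph G" "component L (del_verts G B)" "e \<in> edges G"
    "ends G e \<inter> verts L \<noteq> {}" "\<not> ends G e \<subseteq> verts L"
  shows "ends G e \<inter> B \<noteq> {}"
proof
  assume "ends G e \<inter> B = {}"
  then have "e \<in> edges (del_verts G B)" using assms(3) by (simp add: del_verts_def)
  from component_edge_closed[OF multigraph_del_verts[OF assms(1)] assms(2) this] assms(4,5)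
  show False by (simp add: del_verts_def)
qed

text \<open>An edge leaving a component of \<open>G - B\<close> has its other end in
  \<open>B\<close>, so it leaves only one component. \<open>F\<close> will be a matching or the edge
  set of \<open>H\<close>.\<close>

lemma sum_card_cut_components_le:
  assumes G: "multigraph G" and F: "F \<subseteq> edges G"
  shows "(\<Sum>L\<in>{L. component L (del_verts G B)}. card (edge_cut (ends G) F (verts L))) \<le>
    card {e \<in> F. ends G e \<inter> B \<noteq> {}}"
proof -
  let ?C = "{L. component L (del_verts G B)}"
  have fin: "finite F" using F multigraphD(2)[OF G] by (rule finite_subset)
  have finC: "finite ?C" using finite_Collect_component[OF multigraph_del_verts[OF G]] .
  have meets: "ends G e \<inter> B \<noteq> {}" if "L \<in> ?C" "e \<in> edge_cut (ends G) F (verts L)" for L e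
    using component_cut_meets[OF G, of L B e] that F by (auto simp: edge_cut_def)
  have disj: "edge_cut (ends G) F (verts L) \<inter> edge_cut (ends G) F (verts K) = {}"
    if LK: "L \<in> ?C" "K \<in> ?C" "L \<noteq> K" for L K
  proof (rule ccontr)
    assume "\<not> ?thesis"
    then obtain e where e: "e \<in> edge_cut (ends G) F (verts L)" "e \<in> edge_cut (ends G) F (verts K)"
      by blast
    then have "e \<in> edges G" using F by (auto simp: edge_cut_def)
    then obtain x y where xy: "ends G e = {x, y}" using multigraph_edgeE[OF G] by metis
    have "verts L \<inter> B = {}" "verts K \<inter> B = {}"
      using LK component_subset[of _ "del_verts G B"] by (auto simp: del_verts_def)
    moreover have "{x, y} \<inter> B \<noteq> {}" using meets[OF LK(1) e(1)] xy by simp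
    moreover have "{x, y} \<inter> verts L \<noteq> {}" "{x, y} \<inter> verts K \<noteq> {}"
      using e xy by (auto simp: edge_cut_def)
    ultimately have "verts L \<inter> verts K \<noteq> {}" by blast
    with component_disjoint[OF multigraph_del_verts[OF G]] LK show False by blast
  qed
  have "(\<Sum>L\<in>?C. card (edge_cut (ends G) F (verts L))) = card (\<Union>L\<in>?C. edge_cut (ends G) F (verts L))"
    using finC fin disj by (intro card_UN_disjoint[symmetric]) auto
  also have "\<dots> \<le> card {e \<in> F. ends G e \<inter> B \<noteq> {}}"
    using fin meets by (intro card_mono) (auto simp: edge_cut_def)
  finally show ?thesis .
qed

text \<open>Serves to exploit tight counts: a lower bound that exhausts the total is attained, with
  nothing left elsewhere.\<close>

lemma sum_le_imp_eq:
  fixes f k :: "'a \<Rightarrow> nat"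
  assumes "finite A" "A' \<subseteq> A" "\<And>x. x \<in> A' \<Longrightarrow> k x \<le> f x" "sum f A \<le> sum k A'"
  shows "x \<in> A' \<Longrightarrow> f x = k x" and "x \<in> A - A' \<Longrightarrow> f x = 0"
proof -
  have finA': "finite A'" using assms(1,2) by (rule finite_subset[rotated])
  have split: "sum f A = sum f (A - A') + sum f A'" using assms(1,2) by (rule sum.subset_diff[rotated])
  have le: "sum k A' \<le> sum f A'" using assms(3) by (rule sum_mono)
  then have "sum f (A - A') = 0" "sum f A' = sum k A'" using assms(4) split by linarith+
  then show "f x = 0" if "x \<in> A - A'" using that assms(1) by simp
  show "f x = k x" if x: "x \<in> A'"
  proof (rule ccontr)
    assume "f x \<noteq> k x"
    have "sum k A' < sum f A'"
    proof (intro sum_strict_mono_ex1 finA' ballI bexI)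
      show "k x < f x" using assms(3)[OF x] \<open>f x \<noteq> k x\<close> by simp
    qed (use assms(3) x in simp_all)
    with \<open>sum f A' = sum k A'\<close> show False by simp
  qed
qed

locale barrier_graph =
  fixes G :: "('v, 'e) ugraph" and B :: "'v set"
  assumes multigraph_G: "multigraph G" and barrier: "barrier G B"
begin

definition components :: "('v, 'e) ugraph set" where
  "components = {L. component L (del_verts G B)}"

definition odd_components :: "('v, 'e) ugraph set" where
  "odd_components = {L \<in> components. odd (card (verts L))}"

lemma B_subset: "B \<subseteq> verts G"
  using barrier by (simp add: barrier_def)

lemma finite_B: "finite B"
  using B_subset multigraphD(1)[OF multigraph_G] by (rule finite_subset)

lemma card_odd_components: "card odd_components = card B"
  using barrier by (simp add: barrier_def odd_components_def components_def)

lemma finite_components: "finite components"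
  unfolding components_def by (rule finite_Collect_component[OF multigraph_del_verts[OF multigraph_G]])

lemma component_verts:
  assumes "L \<in> components"
  shows "verts L \<subseteq> verts G" "verts L \<inter> B = {}" "verts L \<noteq> {}"
  using assms component_subset component_nonempty
  unfolding components_def by (fastforce simp: del_verts_def)+

lemma in_some_component:
  assumes "v \<in> verts G - B"
  obtains L where "L \<in> components" "v \<in> verts L"
proof -
  have v: "v \<in> verts (del_verts G B)" using assms by (simp add: del_verts_def)
  show thesis
  proof (rule that)
    show "component_at (del_verts G B) v \<in> components"
      unfolding components_def
      using component_component_at[OF multigraph_del_verts[OF multigraph_G] v] by simp
    show "v \<in> verts (component_at (del_verts G B) v)" using v by (simp add: component_at_def)
  qed
qed

lemma components_disjoint:
  assumes "L \<in> components" "K \<in> components" "v \<in> verts L" "v \<in> verts K"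
  shows "L = K"
  using component_disjoint[OF multigraph_del_verts[OF multigraph_G]] assms
  unfolding components_def by blast

lemma sum_card_cut_le:
  "F \<subseteq> edges G \<Longrightarrow> (\<Sum>L\<in>components. card (edge_cut (ends G) F (verts L))) \<le>
    card {e \<in> F. ends G e \<inter> B \<noteq> {}}"
  unfolding components_def by (rule sum_card_cut_components_le[OF multigraph_G])

section \<open>Matching edges between a barrier and the components\<close>

lemma sum_card_matching_cut_le:
  assumes "perfect_matching (del_verts G T) M"
  shows "(\<Sum>L\<in>components. card (edge_cut (ends G) M (verts L))) \<le> card (B - T)"
proof -
  have "M \<subseteq> edges G" using assms by (simp add: perfect_matching_del_verts_iff)
  from sum_card_cut_le[OF this] card_matching_edges_at_le[OF multigraph_G assms B_subset]
  show ?thesis by (rule le_trans)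
qed

lemma card_matching_cut_ge_1:
  assumes "perfect_matching (del_verts G T) M" "L \<in> odd_components" "verts L \<inter> T = {}"
  shows "1 \<le> card (edge_cut (ends G) M (verts L))"
proof -
  have L: "L \<in> components" "odd (card (verts L))" using assms(2) by (auto simp: odd_components_def)
  have "verts L - T = verts L" using assms(3) by blast
  then have "odd (card (edge_cut (ends G) M (verts L)))"
    using even_card_diff_iff_even_card_cut[OF multigraph_G assms(1) component_verts(1)[OF L(1)]] L(2)
    by simp
  then show ?thesis by (cases "card (edge_cut (ends G) M (verts L))") auto
qed

text \<open>Each of the \<open>card B\<close> odd components takes at least one matching edge by
  parity, while \<open>B\<close> can supply at most \<open>card B\<close> of them.\<close>

lemma card_perfect_matching_cut:
  assumes "perfect_matching G M" "L \<in> components"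
  shows "card (edge_cut (ends G) M (verts L)) = of_bool (L \<in> odd_components)"
proof -
  have M: "perfect_matching (del_verts G {}) M" using assms(1) by simp
  have *: "sum (\<lambda>L. card (edge_cut (ends G) M (verts L))) components \<le> sum (\<lambda>_. 1) odd_components"
    using sum_card_matching_cut_le[OF M] card_odd_components by simp
  have sub: "odd_components \<subseteq> components" by (auto simp: odd_components_def)
  show ?thesis
    using sum_le_imp_eq[OF finite_components sub _ *, of L] card_matching_cut_ge_1[OF M] assms(2)
    by (cases "L \<in> odd_components") auto
qed

text \<open>No perfect matching crosses an even component, so no edge of a matching covered graph
  does. By connectivity the component would be the whole graph, which a nonempty \<open>B\<close>
  excludes.\<close>

lemma matching_covered_components_odd:
  assumes "matching_covered G" "B \<noteq> {}"
  shows "odd_components = components"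
proof (rule ccontr)
  assume "odd_components \<noteq> components"
  then obtain L where L: "L \<in> components" "L \<notin> odd_components" by (auto simp: odd_components_def)
  have "edge_cut (ends G) (edges G) (verts L) = {}"
  proof (rule ccontr)
    assume "edge_cut (ends G) (edges G) (verts L) \<noteq> {}"
    then obtain e where e: "e \<in> edge_cut (ends G) (edges G) (verts L)" by blast
    then obtain M where M: "perfect_matching G M" "e \<in> M"
      using assms(1) by (auto simp: matching_covered_def edge_cut_def)
    then have "e \<in> edge_cut (ends G) M (verts L)" using e by (auto simp: edge_cut_def)
    moreover have "finite M"
      using M(1) multigraphD(2)[OF multigraph_G] by (auto simp: perfect_matching_def intro: finite_subset)
    ultimately show False
      using card_perfect_matching_cut[OF M(1) L(1)] L(2) by auto
  qed
  moreover have "verts L \<noteq> verts G"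
    using component_verts[OF L(1)] assms(2) B_subset by blast
  ultimately show False
    using connected_cut_nonempty[OF multigraph_G _ component_verts(1)[OF L(1)] component_verts(3)[OF L(1)]]
      assms(1) by (simp add: matching_covered_def)
qed

text \<open>Deleting two barrier vertices leaves fewer vertices in \<open>B\<close> than odd
  components that need one.\<close>

lemma not_two_in_barrier:
  assumes "perfect_matching (del_verts G {x, y}) M" "x \<in> B" "y \<in> B" "x \<noteq> y"
  shows False
proof -
  have sub: "odd_components \<subseteq> components" by (auto simp: odd_components_def)
  have "card odd_components = (\<Sum>L\<in>odd_components. 1)" by simp
  also have "\<dots> \<le> (\<Sum>L\<in>odd_components. card (edge_cut (ends G) M (verts L)))"
  proof (rule sum_mono)
    fix L assume L: "L \<in> odd_components"
    then have "verts L \<inter> {x, y} = {}" using component_verts(2) assms(2,3) sub by blast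
    then show "1 \<le> card (edge_cut (ends G) M (verts L))"
      using card_matching_cut_ge_1[OF assms(1) L] by blast
  qed
  also have "\<dots> \<le> (\<Sum>L\<in>components. card (edge_cut (ends G) M (verts L)))"
    using finite_components sub by (intro sum_mono2) auto
  also have "\<dots> \<le> card (B - {x, y})" by (rule sum_card_matching_cut_le[OF assms(1)])
  also have "\<dots> < card B"
    using assms(2) finite_B by (intro psubset_card_mono) auto
  finally show False using card_odd_components by simp
qed

text \<open>With \<open>x\<close> gone, \<open>card B - 1\<close> vertices of \<open>B\<close>
  remain, and the odd components other than \<open>L\<close> use up all of them.\<close>

lemma matching_cut_empty:
  assumes M: "perfect_matching (del_verts G {x, y}) M" and "x \<in> B" "y \<in> verts L"
    and L: "L \<in> odd_components"
  shows "edge_cut (ends G) M (verts L) = {}"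
proof -
  have sub: "odd_components - {L} \<subseteq> components" and L': "L \<in> components"
    using L by (auto simp: odd_components_def)
  have "y \<notin> B" using component_verts(2)[OF L'] assms(3) by blast
  then have "B - {x, y} = B - {x}" by blast
  moreover have "finite odd_components"
    using finite_components by (simp add: odd_components_def)
  ultimately have "card (B - {x, y}) = card (odd_components - {L})"
    using L assms(2) finite_B card_odd_components by simp
  then have *: "sum (\<lambda>K. card (edge_cut (ends G) M (verts K))) components \<le> sum (\<lambda>_. 1) (odd_components - {L})"
    using sum_card_matching_cut_le[OF M] by simp
  have "1 \<le> card (edge_cut (ends G) M (verts K))" if K: "K \<in> odd_components - {L}" for K
  proof -
    have "x \<notin> verts K" using component_verts(2)[of K] assms(2) sub K by blast
    moreover have "y \<notin> verts K" using components_disjoint[OF L', of K y] assms(3) sub K by blast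
    ultimately show ?thesis using card_matching_cut_ge_1[OF M, of K] K by blast
  qed
  from sum_le_imp_eq(2)[OF finite_components sub this *, of L] L'
  have "card (edge_cut (ends G) M (verts L)) = 0" by simp
  moreover have "finite M"
    using M multigraphD(2)[OF multigraph_G]
    by (auto simp: perfect_matching_del_verts_iff intro: finite_subset)
  ultimately show ?thesis by simp
qed

end

section \<open>Bisubdivisions and barriers\<close>

locale based_barrier_graph = barrier_graph G B + bisubdivided H J \<phi> pv pe
  for G H :: "('w, 'f) ugraph" and B :: "'w set" and J :: "('v, 'e) ugraph"
    and \<phi> :: "'v \<Rightarrow> 'w" and pv :: "'e \<Rightarrow> 'w list" and pe :: "'e \<Rightarrow> 'f list" +
  fixes M0 :: "'f set"
  assumes bicritical_J: "bicritical J" and cubic_J: "cubic J"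
    and matching_covered_G: "matching_covered G"
    and subgraph_H: "subgraph H G"
    and matching_M0: "perfect_matching (del_verts G (verts H)) M0"
begin

definition branches :: "('w, 'f) ugraph \<Rightarrow> 'v set" where
  "branches L = {v \<in> verts J. \<phi> v \<in> verts L}"

definition crossings :: "('w, 'f) ugraph \<Rightarrow> nat" where
  "crossings L = card (edge_cut (ends G) (edges H) (verts L))"

lemma ends_H: "ends H = ends G"
  using subgraph_H by (simp add: subgraph_def)

lemma edges_H_subset: "edges H \<subseteq> edges G"
  using subgraph_H by (simp add: subgraph_def)

lemma verts_H_subset: "verts H \<subseteq> verts G"
  using subgraph_H by (simp add: subgraph_def)

lemma M0_subset: "M0 \<subseteq> edges G"
  using matching_M0 by (simp add: perfect_matching_del_verts_iff)

lemma finite_H: "finite (edges H)"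
  using multigraphD(2)[OF multigraph_H] .

lemma finite_M0: "finite M0"
  using M0_subset multigraphD(2)[OF multigraph_G] by (rule finite_subset)

lemma branch_in_G: "v \<in> verts J \<Longrightarrow> \<phi> v \<in> verts G"
  using verts_H verts_H_subset by blast

lemma edge_cut_outside:
  "F \<subseteq> edges G \<Longrightarrow> edge_cut (ends G) F (verts G - S) = edge_cut (ends G) F S"
  using multigraphD(3)[OF multigraph_G] by (intro edge_cut_compl) blast

lemma lifted_perfect_matching:
  assumes "T \<subseteq> verts J" "perfect_matching (del_verts J T) P"
  shows "perfect_matching (del_verts G (\<phi> ` T)) (lift_matching P \<union> M0)"
  using perfect_matching_lift[OF assms] perfect_matching_Un[OF subgraph_H matching_M0, of "\<phi> ` T"]
    assms(1) verts_H by blast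

text \<open>The lifted matching and \<open>M0\<close> form a perfect matching of \<open>G\<close>,
  which crosses once. As \<open>M0\<close> is fixed, it does not depend on \<open>P\<close> which of
  the two crosses.\<close>

lemma card_lifted_cut:
  assumes P: "perfect_matching J P" and L: "L \<in> odd_components"
  shows "card (edge_cut (ends G) (lift_matching P) (verts L)) +
    card (edge_cut (ends G) M0 (verts L)) = 1"
proof -
  have pm: "perfect_matching G (lift_matching P \<union> M0)"
    using lifted_perfect_matching[of "{}" P] P by simp
  have "ends G e \<subseteq> verts H" "ends G e \<noteq> {}" if "e \<in> edges H" for e
    using multigraphD(3,4)[OF multigraph_H that] ends_H by auto
  moreover have "ends G e \<inter> verts H = {}" if "e \<in> M0" for e
    using matching_M0 that by (simp add: perfect_matching_del_verts_iff)
  ultimately have "lift_matching P \<inter> M0 = {}"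
    using lift_matching_subset[of P] by blast
  then have "edge_cut (ends G) (lift_matching P) (verts L) \<inter> edge_cut (ends G) M0 (verts L) = {}"
    by (auto simp: edge_cut_def)
  moreover have "edge_cut (ends G) (lift_matching P \<union> M0) (verts L) =
      edge_cut (ends G) (lift_matching P) (verts L) \<union> edge_cut (ends G) M0 (verts L)"
    by (auto simp: edge_cut_def)
  moreover have "finite (lift_matching P)"
    using lift_matching_subset finite_H by (rule finite_subset)
  moreover have "card (edge_cut (ends G) (lift_matching P \<union> M0) (verts L)) = 1"
    using card_perfect_matching_cut[OF pm, of L] L by (simp add: odd_components_def)
  ultimately show ?thesis using finite_M0 by (simp add: card_Un_disjoint)
qed

lemma perfect_matching_J: obtains P where "perfect_matching J P"
  using bicritical_J by (auto simp: bicritical_def matchable_def)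

text \<open>An edge at an even position lies in the lift of a matching containing \<open>e\<close>,
  one at an odd position in the lift of a matching avoiding \<open>e\<close>.\<close>

lemma H_matching_covered:
  assumes "f \<in> edges H"
  obtains P where "perfect_matching J P" "f \<in> lift_matching P"
proof -
  obtain e i where ei: "e \<in> edges J" "i < length (pe e)" "f = pe e ! i"
    using edge_of_H_cases[OF assms] .
  show thesis
  proof (cases "even i")
    case True
    obtain P where "perfect_matching J P" "e \<in> P"
      using perfect_matching_containing[OF multigraph_J bicritical_J ei(1)] .
    with True ei that show thesis by (simp add: nth_mem_lift_matching_iff)
  next
    case False
    obtain P where "perfect_matching J P" "e \<notin> P"
      using perfect_matching_avoiding[OF multigraph_J bicritical_J cubic_J ei(1)] .
    with False ei that show thesis by (simp add: nth_mem_lift_matching_iff)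
  qed
qed

text \<open>An edge of \<open>H\<close> in the cut lies in some lifted matching and would be a
  second crossing beside that of \<open>M0\<close>.\<close>

lemma crossings_eq_0:
  assumes "L \<in> odd_components" "edge_cut (ends G) M0 (verts L) \<noteq> {}"
  shows "crossings L = 0"
proof -
  have "edge_cut (ends G) (edges H) (verts L) = {}"
  proof (rule ccontr)
    assume "\<not> ?thesis"
    then obtain f where f: "f \<in> edge_cut (ends G) (edges H) (verts L)" by blast
    then obtain P where P: "perfect_matching J P" "f \<in> lift_matching P"
      using H_matching_covered[of f] by (auto simp: edge_cut_def)
    have "f \<in> edge_cut (ends G) (lift_matching P) (verts L)" using f P(2) by (auto simp: edge_cut_def)
    moreover have "finite (lift_matching P)"
      using lift_matching_subset finite_H by (rule finite_subset)
    ultimately have "card (edge_cut (ends G) (lift_matching P) (verts L)) \<noteq> 0" by auto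
    moreover have "card (edge_cut (ends G) M0 (verts L)) \<noteq> 0" using assms(2) finite_M0 by simp
    ultimately show False using card_lifted_cut[OF P(1) assms(1)] by linarith
  qed
  then show ?thesis by (simp add: crossings_def)
qed

text \<open>The cut of \<open>L\<close> in \<open>H\<close> is at least as large as the induced cut
  in \<open>J\<close>, which has three edges unless one side is empty.\<close>

lemma branches_trivial:
  assumes "crossings L \<le> 2"
  shows "branches L = {} \<or> branches L = verts J"
proof (rule ccontr)
  assume "\<not> ?thesis"
  then have "3 \<le> card (edge_cut (ends J) (edges J) (branches L))"
    using bicritical_cubic_card_cut_ge_3[OF multigraph_J bicritical_J cubic_J, of "branches L"]
    by (auto simp: branches_def)
  also have "\<dots> \<le> crossings L"
    using card_cut_J_le[of "verts L"] by (simp add: branches_def crossings_def ends_H)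
  finally show False using assms by simp
qed

text \<open>With at most one crossing all branch vertices would be on one side, so the number of
  crossings would be even, hence 0; yet every lifted matching must cross.\<close>

lemma crossings_ge_2:
  assumes "L \<in> odd_components" "edge_cut (ends G) M0 (verts L) = {}"
  shows "2 \<le> crossings L"
proof (rule ccontr)
  assume "\<not> ?thesis"
  then have le: "crossings L \<le> 1" by simp
  then have "even (crossings L)"
    using branches_trivial[of L] even_card_cut_H[of "verts L"]
    by (simp add: branches_def crossings_def ends_H)
  with le have "crossings L = 0" by (auto simp: le_Suc_eq)
  then have empty: "edge_cut (ends G) (edges H) (verts L) = {}"
    using finite_H by (simp add: crossings_def)
  obtain P where P: "perfect_matching J P" using perfect_matching_J .
  have "edge_cut (ends G) (lift_matching P) (verts L) = {}"
    using empty edge_cut_mono[OF lift_matching_subset] by blast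
  with card_lifted_cut[OF P assms(1)] assms(2) show False by simp
qed

text \<open>Two branch vertices in the barrier could be deleted without losing matchability.\<close>

lemma card_branches_in_barrier_le: "card {v \<in> verts J. \<phi> v \<in> B} \<le> 1"
proof -
  have "u = v" if uv: "u \<in> verts J" "v \<in> verts J" "\<phi> u \<in> B" "\<phi> v \<in> B" for u v
  proof (rule ccontr)
    assume "u \<noteq> v"
    then obtain P where "perfect_matching (del_verts J {u, v}) P"
      using bicritical_J uv unfolding bicritical_def matchable_def by blast
    then have "perfect_matching (del_verts G {\<phi> u, \<phi> v}) (lift_matching P \<union> M0)"
      using lifted_perfect_matching[of "{u, v}" P] uv by simp
    moreover have "\<phi> u \<noteq> \<phi> v" using \<open>u \<noteq> v\<close> uv inj_branch by (auto dest: inj_onD)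
    ultimately show False using not_two_in_barrier uv by blast
  qed
  then show ?thesis
    using multigraphD(1)[OF multigraph_J] by (auto simp: card_le_Suc0_iff_eq)
qed

section \<open>Counting the crossings of \<open>H\<close>\<close>

text \<open>Every crossing is an edge of \<open>H\<close> at a vertex of \<open>B\<close>; such a
  vertex offers at most two edges, or three if it is a branch vertex.\<close>

lemma sum_crossings_le:
  "(\<Sum>L\<in>components. crossings L) \<le> 2 * card (B \<inter> verts H) + card {v \<in> verts J. \<phi> v \<in> B}"
proof -
  have fin: "finite (B \<inter> verts H)" using finite_B by simp
  have "{f \<in> edges H. ends G f \<inter> B \<noteq> {}} \<subseteq> (\<Union>x\<in>B \<inter> verts H. {f \<in> edges H. x \<in> ends H f})"
    using multigraphD(3)[OF multigraph_H] ends_H by auto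
  then have "card {f \<in> edges H. ends G f \<inter> B \<noteq> {}} \<le>
      card (\<Union>x\<in>B \<inter> verts H. {f \<in> edges H. x \<in> ends H f})"
    using finite_H fin by (intro card_mono) auto
  also have "\<dots> \<le> (\<Sum>x\<in>B \<inter> verts H. card {f \<in> edges H. x \<in> ends H f})"
    using fin by (rule card_UN_le)
  also have "\<dots> \<le> (\<Sum>x\<in>B \<inter> verts H. 2 + of_bool (x \<in> \<phi> ` verts J))"
  proof (rule sum_mono)
    fix x assume x: "x \<in> B \<inter> verts H"
    show "card {f \<in> edges H. x \<in> ends H f} \<le> 2 + of_bool (x \<in> \<phi> ` verts J)"
    proof (cases "x \<in> \<phi> ` verts J")
      case True
      then obtain v where v: "v \<in> verts J" "x = \<phi> v" by blast
      then show ?thesis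
        using card_edges_at_branch_le[OF v(1)] cubic_J True by (simp add: cubic_def)
    next
      case False
      then show ?thesis using card_edges_at_inner_le[of x] x by simp
    qed
  qed
  also have "\<dots> = 2 * card (B \<inter> verts H) + card (B \<inter> verts H \<inter> \<phi> ` verts J)"
    using fin by (simp only: sum.distrib) (simp add: sum_of_bool_eq)
  also have "card (B \<inter> verts H \<inter> \<phi> ` verts J) \<le> card {v \<in> verts J. \<phi> v \<in> B}"
  proof (rule surj_card_le)
    show "finite {v \<in> verts J. \<phi> v \<in> B}" using multigraphD(1)[OF multigraph_J] by simp
    show "B \<inter> verts H \<inter> \<phi> ` verts J \<subseteq> \<phi> ` {v \<in> verts J. \<phi> v \<in> B}" by blast
  qed
  finally show ?thesis
    using sum_card_cut_le[OF edges_H_subset] unfolding crossings_def by linarith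
qed

text \<open>The condition is on \<open>M0\<close>, but for odd components
  \<open>crossings_eq_0\<close> and \<open>crossings_ge_2\<close> make it equivalent to being
  crossed by \<open>H\<close>.\<close>

definition crossed_components :: "('w, 'f) ugraph set" where
  "crossed_components = {L \<in> components. edge_cut (ends G) M0 (verts L) = {}}"

text \<open>Every other component uses up a vertex of \<open>B\<close> outside \<open>H\<close>
  through an edge of \<open>M0\<close>, and there are as many components as barrier
  vertices.\<close>

lemma card_crossed_components_ge:
  assumes "odd_components = components"
  shows "card (B \<inter> verts H) \<le> card crossed_components"
proof -
  have "card (components - crossed_components) = (\<Sum>L\<in>components - crossed_components. 1)" by simp
  also have "\<dots> \<le> (\<Sum>L\<in>components - crossed_components. card (edge_cut (ends G) M0 (verts L)))"
  proof (rule sum_mono)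
    fix L assume "L \<in> components - crossed_components"
    then show "1 \<le> card (edge_cut (ends G) M0 (verts L))"
      using finite_M0 by (simp add: crossed_components_def Suc_le_eq card_gt_0_iff)
  qed
  also have "\<dots> \<le> (\<Sum>L\<in>components. card (edge_cut (ends G) M0 (verts L)))"
    using finite_components by (intro sum_mono2) auto
  also have "\<dots> \<le> card (B - verts H)" by (rule sum_card_matching_cut_le[OF matching_M0])
  finally have "card (components - crossed_components) \<le> card (B - verts H)" .
  moreover have "card components = card (components - crossed_components) + card crossed_components"
    using finite_components card_Diff_subset[of crossed_components components]
      card_mono[of components crossed_components]
    by (auto simp: crossed_components_def)
  moreover have "card B = card (B - verts H) + card (B \<inter> verts H)"
    using finite_B by (metis card_Diff_subset_Int card_mono Int_lower1 finite_Int le_add_diff_inverse2)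
  moreover have "card components = card B" using card_odd_components assms by simp
  ultimately show ?thesis by linarith
qed

section \<open>Components that give a \<open>J\<close>-based graph\<close>

text \<open>If \<open>H\<close> lies in \<open>L\<close>, the new vertex is still to be matched, by
  the one crossing of \<open>M0\<close>; otherwise it belongs to the shrunk \<open>H\<close>, and
  \<open>M0\<close> must not reach it. If \<open>L\<close> spans \<open>G\<close>, no new vertex
  arises.\<close>

lemma based_shrink_compl:
  assumes L: "L \<in> components"
    and one: "\<And>M. perfect_matching G M \<Longrightarrow> verts L \<noteq> verts G \<Longrightarrow>
      card (edge_cut (ends G) M (verts L)) = 1"
    and bis: "bisubdivision (shrink H (verts G - verts L)) J"
    and H_inside: "verts H \<subseteq> verts L \<Longrightarrow> verts L \<noteq> verts G \<Longrightarrow>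
      card (edge_cut (ends G) M0 (verts L)) = 1"
    and H_outside: "\<not> verts H \<subseteq> verts L \<Longrightarrow> edge_cut (ends G) M0 (verts L) = {}"
  shows "based J (shrink_compl G (verts L))"
proof -
  let ?Y = "verts G - verts L"
  have M_sub: "M \<subseteq> edges G" if "perfect_matching G M" for M
    using that by (simp add: perfect_matching_def)
  have "?Y \<subset> verts G" using component_verts[OF L] by blast
  then have covered: "matching_covered (shrink G ?Y)"
  proof (rule matching_covered_shrink[OF multigraph_G matching_covered_G])
    fix M assume "perfect_matching G M" "?Y \<noteq> {}"
    moreover from this have "verts L \<noteq> verts G" by blast
    ultimately show "card (edge_cut (ends G) M ?Y) = 1"
      using one[of M] edge_cut_outside[OF M_sub[of M]] by simp
  qed
  have "perfect_matching (del_verts (shrink G ?Y) (shrink_map ?Y ` verts H)) {e \<in> M0. \<not> ends G e \<subseteq> ?Y}"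
  proof (rule perfect_matching_shrink[OF multigraph_G matching_M0 verts_H_subset])
    show "card (edge_cut (ends G) M0 ?Y) = 1" if "?Y \<noteq> {}" "verts H \<inter> ?Y = {}"
    proof -
      have "verts H \<subseteq> verts L" "verts L \<noteq> verts G" using that verts_H_subset by blast+
      then show ?thesis using H_inside edge_cut_outside[OF M0_subset] by simp
    qed
    show "edge_cut (ends G) M0 ?Y = {}" if "verts H \<inter> ?Y \<noteq> {}"
    proof -
      have "\<not> verts H \<subseteq> verts L" using that by blast
      then show ?thesis using H_outside edge_cut_outside[OF M0_subset] by simp
    qed
  qed auto
  moreover have "subgraph (shrink H ?Y) (shrink G ?Y)"
    unfolding subgraph_def
  proof (intro conjI)
    show "multigraph (shrink H ?Y)" by (rule multigraph_shrink[OF multigraph_H])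
    show "verts (shrink H ?Y) \<subseteq> verts (shrink G ?Y)"
      unfolding shrink_sel by (rule image_mono[OF verts_H_subset])
    show "edges (shrink H ?Y) \<subseteq> edges (shrink G ?Y)"
      using edges_H_subset by (auto simp: shrink_sel ends_H)
    show "ends (shrink H ?Y) = ends (shrink G ?Y)"
      by (rule ext) (simp only: shrink_sel ends_H)
  qed
  ultimately have "conformal (shrink H ?Y) (shrink G ?Y)"
    unfolding conformal_def matchable_def shrink_sel(1)[of H] by blast
  with covered bis show ?thesis
    unfolding based_def shrink_compl_def by blast
qed

lemma branches_outside:
  "{v \<in> verts J. \<phi> v \<in> verts G - verts L} = verts J - branches L"
  using branch_in_G by (auto simp: branches_def)

lemma card_cut_outside:
  "card (edge_cut (ends H) (edges H) (verts G - verts L)) = crossings L"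
  unfolding ends_H crossings_def by (simp only: edge_cut_outside[OF edges_H_subset])

lemma based_if_all_branches_uncrossed:
  assumes L: "L \<in> odd_components" and br: "branches L = verts J" and "crossings L = 0"
  shows "based J (shrink_compl G (verts L))"
proof -
  let ?Y = "verts G - verts L"
  have L': "L \<in> components" using L by (simp add: odd_components_def)
  have disj: "\<phi> ` verts J \<inter> ?Y = {}" using br by (auto simp: branches_def)
  have empty: "edge_cut (ends G) (edges H) (verts L) = {}"
    using assms(3) finite_H by (simp add: crossings_def)
  then have empty': "edge_cut (ends H) (edges H) ?Y = {}"
    unfolding ends_H by (simp only: edge_cut_outside[OF edges_H_subset])
  have inside: "verts H \<subseteq> verts L"
    using verts_H_disjoint[OF disj empty'] verts_H_subset by blast
  obtain P where P: "perfect_matching J P" using perfect_matching_J .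
  have "edge_cut (ends G) (lift_matching P) (verts L) = {}"
    using empty edge_cut_mono[OF lift_matching_subset] by blast
  with card_lifted_cut[OF P L] have "card (edge_cut (ends G) M0 (verts L)) = 1" by simp
  moreover have "bisubdivision (shrink H ?Y) J"
    using bisubdivision_shrink_no_branch[OF disj] empty' by simp
  ultimately show ?thesis
    using based_shrink_compl[OF L'] card_perfect_matching_cut[OF _ L'] L inside by simp
qed

text \<open>The two crossings bound one gap. As \<open>M0\<close> does not cross, each lifted
  perfect matching crosses exactly once, which settles the parity of the shrunk path.\<close>

lemma based_if_all_branches_crossed:
  assumes L: "L \<in> odd_components" and br: "branches L = verts J" and two: "crossings L = 2"
    and M0: "edge_cut (ends G) M0 (verts L) = {}"
  shows "based J (shrink_compl G (verts L))"
proof -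
  let ?Y = "verts G - verts L"
  have L': "L \<in> components" using L by (simp add: odd_components_def)
  have disj: "\<phi> ` verts J \<inter> ?Y = {}" using br by (auto simp: branches_def)
  have "bisubdivision (shrink H ?Y) J"
  proof (rule bisubdivision_shrink_no_branch[OF disj])
    show "card (edge_cut (ends H) (edges H) ?Y) \<le> 2" by (simp only: card_cut_outside two)
    fix e assume "e \<in> edges J"
    then obtain P where P: "perfect_matching J P" "e \<in> P"
      using perfect_matching_containing[OF multigraph_J bicritical_J] by blast
    have "card (edge_cut (ends G) (lift_matching P) (verts L)) = 1"
      using card_lifted_cut[OF P(1) L] M0 by simp
    moreover have "edge_cut (ends H) (lift_matching P) ?Y = edge_cut (ends G) (lift_matching P) (verts L)"
      unfolding ends_H using lift_matching_subset edges_H_subset by (intro edge_cut_outside) blast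
    ultimately show "\<exists>P. e \<in> P \<and> card (edge_cut (ends H) (lift_matching P) ?Y) = 1"
      using P(2) by auto
  qed
  moreover have "\<not> verts H \<subseteq> verts L"
  proof
    assume "verts H \<subseteq> verts L"
    then have "edge_cut (ends G) (edges H) (verts L) = {}"
      using multigraphD(3)[OF multigraph_H] unfolding edge_cut_def ends_H by blast
    with two show False by (simp add: crossings_def)
  qed
  ultimately show ?thesis
    using based_shrink_compl[OF L'] card_perfect_matching_cut[OF _ L'] L M0 by simp
qed

lemma based_if_one_branch_outside:
  assumes L: "L \<in> odd_components" and u: "u \<in> verts J" "\<phi> u \<in> B"
    and br: "branches L = verts J - {u}" and three: "crossings L = 3"
    and M0: "edge_cut (ends G) M0 (verts L) = {}"
  shows "based J (shrink_compl G (verts L))"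
proof -
  let ?Y = "verts G - verts L"
  have L': "L \<in> components" using L by (simp add: odd_components_def)
  have out: "{v \<in> verts J. \<phi> v \<in> ?Y} = {u}"
    unfolding branches_outside br using u by blast
  have "2 \<le> card (verts J)"
    using cubic_card_verts_ge_2[OF multigraph_J cubic_J] u by blast
  then have "verts J \<noteq> {u}" by auto
  \<comment> \<open>Any second branch vertex serves as \<open>w\<close>: deleting
    \<open>\<phi> u\<close> in \<open>B\<close> and \<open>\<phi> w\<close> in \<open>L\<close>
    gives a matching that does not cross \<open>L\<close>, as the parity of the paths at
    \<open>u\<close> demands.\<close>
  then obtain w where w: "w \<in> verts J" "w \<noteq> u" using u by blast
  then have "\<phi> w \<in> verts L" using br by (auto simp: branches_def)
  obtain P where P: "perfect_matching (del_verts J {u, w}) P"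
    using bicritical_J u(1) w unfolding bicritical_def matchable_def by metis
  have "perfect_matching (del_verts G {\<phi> u, \<phi> w}) (lift_matching P \<union> M0)"
    using lifted_perfect_matching[OF _ P] u(1) w(1) by simp
  from matching_cut_empty[OF this u(2) \<open>\<phi> w \<in> verts L\<close> L]
  have "edge_cut (ends G) (lift_matching P) (verts L) = {}"
    by (auto simp: edge_cut_def)
  then have P_cut: "edge_cut (ends H) (lift_matching P) ?Y = {}"
    unfolding ends_H using lift_matching_subset edges_H_subset by (subst edge_cut_outside) blast+
  have "u \<notin> ends J e" if "e \<in> P" for e
    using P that by (auto simp: perfect_matching_del_verts_iff)
  moreover have "card (edge_cut (ends H) (edges H) ?Y) \<le> card {e \<in> edges J. u \<in> ends J e}"
    unfolding card_cut_outside three using cubic_J u(1) by (simp add: cubic_def)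
  ultimately have "bisubdivision (shrink H ?Y) J"
    using bisubdivision_shrink_one_branch[OF out _ _ P_cut] by blast
  moreover have "\<not> verts H \<subseteq> verts L"
    using out u(1) verts_H by blast
  ultimately show ?thesis
    using based_shrink_compl[OF L'] card_perfect_matching_cut[OF _ L'] L M0 by simp
qed

lemma based_if_barrier_nonempty:
  assumes "B \<noteq> {}"
  shows "\<exists>L\<in>components. based J (shrink_compl G (verts L))"
proof (cases "\<exists>L\<in>components. branches L = verts J \<and> crossings L \<le> 2")
  case True
  have odd: "odd_components = components"
    using matching_covered_components_odd[OF matching_covered_G assms] .
  from True obtain L where L: "L \<in> components" "branches L = verts J" "crossings L \<le> 2" by blast
  show ?thesis
  proof (cases "edge_cut (ends G) M0 (verts L) = {}")
    case True
    then have "crossings L = 2" using crossings_ge_2[of L] L odd by simp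
    then show ?thesis using based_if_all_branches_crossed[of L] L odd True by blast
  next
    case False
    then have "crossings L = 0" using crossings_eq_0[of L] L odd by simp
    then show ?thesis using based_if_all_branches_uncrossed[of L] L odd by blast
  qed
next
  case False
  have odd: "odd_components = components"
    using matching_covered_components_odd[OF matching_covered_G assms] .
  have sub: "crossed_components \<subseteq> components" by (auto simp: crossed_components_def)
  have fin: "finite crossed_components" using sub finite_components by (rule finite_subset)
  have no_branch: "branches L = {}" if "L \<in> components" "crossings L \<le> 2" for L
    using branches_trivial[OF that(2)] False that by blast
  have ge2: "2 \<le> crossings L" if "L \<in> crossed_components" for L
    using crossings_ge_2[of L] that odd by (simp add: crossed_components_def)
  have uncrossed: "crossings L = 0" if "L \<in> components" "L \<notin> crossed_components" for L
    using crossings_eq_0[of L] that odd by (simp add: crossed_components_def)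
  let ?b = "card {v \<in> verts J. \<phi> v \<in> B}"
  have total: "(\<Sum>L\<in>components. crossings L) \<le> 2 * card crossed_components + ?b"
    using sum_crossings_le card_crossed_components_ge[OF odd] by linarith
  \<comment> \<open>Otherwise no component contains a branch vertex, so all of them lie in
    \<open>B\<close>, where there is room for only one.\<close>
  have "\<exists>L\<in>components. \<not> crossings L \<le> 2"
  proof (rule ccontr)
    assume "\<not> ?thesis"
    then have no: "branches L = {}" if "L \<in> components" for L using no_branch that by blast
    have "\<phi> v \<in> B" if v: "v \<in> verts J" for v
    proof (rule ccontr)
      assume "\<phi> v \<notin> B"
      then obtain L where "L \<in> components" "\<phi> v \<in> verts L"
        using in_some_component[of "\<phi> v"] branch_in_G[OF v] by blast
      with no[of L] v show False by (auto simp: branches_def)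
    qed
    then have "{v \<in> verts J. \<phi> v \<in> B} = verts J" by blast
    \<comment> \<open>The null graph is cubic and bicritical. For it every component trivially
      contains all branch vertices, against the case assumption.\<close>
    then have "verts J = {}"
      using card_branches_in_barrier_le cubic_card_verts_ge_2[OF multigraph_J cubic_J] by fastforce
    moreover obtain L where "L \<in> components"
      using card_odd_components assms finite_B odd by (metis card_0_eq card.empty ex_in_conv)
    ultimately show False using no False \<open>\<not> (\<exists>L\<in>components. \<not> crossings L \<le> 2)\<close> by metis
  qed
  then obtain L where L: "L \<in> components" "\<not> crossings L \<le> 2" by blast
  then have L': "L \<in> crossed_components" using uncrossed[of L] by fastforce
  \<comment> \<open>Lower bounds for the crossings: two for each crossed component and one more for
    \<open>L\<close>. Their sum meets the upper bound \<open>total\<close>, so a branch vertex lies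
    in \<open>B\<close> and every bound is attained.\<close>
  let ?k = "\<lambda>K. 2 + of_bool (K = L) :: nat"
  have k: "sum ?k crossed_components = 2 * card crossed_components + 1"
    using fin L' by (simp only: sum.distrib) (simp add: sum_of_bool_eq)
  have k_le: "?k K \<le> crossings K" if "K \<in> crossed_components" for K
    using ge2[OF that] L by (cases "K = L") auto
  have "sum ?k crossed_components \<le> (\<Sum>K\<in>crossed_components. crossings K)"
    using k_le by (rule sum_mono)
  also have "\<dots> \<le> (\<Sum>K\<in>components. crossings K)"
    using finite_components sub by (intro sum_mono2) auto
  finally have "1 \<le> ?b" using k total by linarith
  then have b: "?b = 1" using card_branches_in_barrier_le by linarith
  then obtain u where u: "{v \<in> verts J. \<phi> v \<in> B} = {u}" using card_1_singletonE by blast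
  have "(\<Sum>K\<in>components. crossings K) \<le> sum ?k crossed_components"
    using total b k by simp
  then have eq: "crossings K = ?k K" if "K \<in> crossed_components" for K
    using sum_le_imp_eq(1)[OF finite_components sub, of ?k crossings K] k_le that by blast
  have "crossings L = 3" using eq[OF L'] by simp
  have others: "branches K = {}" if K: "K \<in> components" "K \<noteq> L" for K
  proof (rule no_branch[OF K(1)])
    show "crossings K \<le> 2"
      using eq[of K] uncrossed[OF K(1)] K(2) by (cases "K \<in> crossed_components") simp_all
  qed
  have "branches L = verts J - {u}"
  proof -
    have "\<phi> v \<in> verts L" if v: "v \<in> verts J" "v \<noteq> u" for v
    proof -
      have "\<phi> v \<notin> B" using u v by blast
      then obtain K where "K \<in> components" "\<phi> v \<in> verts K"
        using in_some_component[of "\<phi> v"] branch_in_G[OF v(1)] by blast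
      with others[of K] v(1) show ?thesis by (cases "K = L") (auto simp: branches_def)
    qed
    moreover have "\<phi> u \<notin> verts L" using component_verts(2)[OF L(1)] u by blast
    ultimately show ?thesis by (auto simp: branches_def)
  qed
  moreover have "u \<in> verts J" "\<phi> u \<in> B" using u by blast+
  ultimately have "based J (shrink_compl G (verts L))"
    using based_if_one_branch_outside[of L u] L(1) odd L' \<open>crossings L = 3\<close>
    by (simp add: crossed_components_def)
  with L(1) show ?thesis by blast
qed

text \<open>A connected \<open>G\<close> is its own component, and nothing is shrunk.\<close>

lemma based_if_barrier_empty:
  assumes "B = {}"
  shows "\<exists>L\<in>components. based J (shrink_compl G (verts L))"
proof -
  have "verts G \<noteq> {}"
    using matching_covered_G by (auto simp: matching_covered_def connected_graph_def)
  then obtain L where L: "L \<in> components" using in_some_component assms by blast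
  have "verts L = verts G"
  proof (rule ccontr)
    assume "verts L \<noteq> verts G"
    then obtain e where "e \<in> edge_cut (ends G) (edges G) (verts L)"
      using connected_cut_nonempty[OF multigraph_G _ component_verts(1)[OF L] component_verts(3)[OF L]]
        matching_covered_G by (auto simp: matching_covered_def)
    then have "ends G e \<inter> B \<noteq> {}"
      using component_cut_meets[OF multigraph_G, of L B e] L
      unfolding components_def edge_cut_def by blast
    with assms show False by simp
  qed
  \<comment> \<open>Shrinking the empty set merely renames each \<open>v\<close> to
    \<open>Some v\<close>.\<close>
  have "bisubdivision (shrink H {}) J"
    by (rule bisubdivision_shrink_no_branch) (simp_all add: edge_cut_def)
  then have "based J (shrink_compl G (verts L))"
    using based_shrink_compl[OF L] \<open>verts L = verts G\<close> verts_H_subset by simp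
  with L show ?thesis by blast
qed

end

theorem theorem44:
  fixes J :: "('a, 'b) ugraph" and G :: "('v, 'e) ugraph" and B :: "'v set"
  assumes "multigraph J" and "bicritical J" and "cubic J"
    and "multigraph G" and "matching_covered G" and "barrier G B"
    and "based J G"
  shows "\<exists>L. component L (del_verts G B) \<and> based J (shrink_compl G (verts L))"
proof -
  obtain H M0 where H: "subgraph H G" "perfect_matching (del_verts G (verts H)) M0" "bisubdivision H J"
    using assms(7) by (auto simp: based_def conformal_def matchable_def)
  have "multigraph H" using H(1) by (simp add: subgraph_def)
  then obtain \<phi> pv pe where "bisubdivided H J \<phi> pv pe"
    using bisubdivisionE[OF H(3) assms(1)] by blast
  then interpret based_barrier_graph G H B J \<phi> pv pe M0
    using assms H by (intro based_barrier_graph.intro barrier_graph.intro based_barrier_graph_axioms.intro)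
  show ?thesis
    using based_if_barrier_empty based_if_barrier_nonempty unfolding components_def by blast
qed

end
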